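(* Let $c\in\mathbb{C}$, $c\neq0$, and let $f$ be a nonconstant meromorphic function on $\mathbb{C}$. Then $f$ is a solution of $$f^3(z)+f^3(z+c)=1$$ if and only if $$f(z)=\frac{\frac12\left\{1+\frac{\wp'(h(z))}{\sqrt3}\right\}}{\wp(h(z))},$$ where $h$ is a nonconstant entire function satisfying one of the following equations: (1) $h(z+c)=Ah(z)+\theta_1+\tau_1$ with some $\tau_1\in\mathbb{L}$; (2) $h(z+c)=Ah(z)+\theta_2+\tau_2$ with some $\tau_2\in\mathbb{L}$; (3) $h(z+c)=Ah(z)+\tau_3$ with some $\tau_3\in\mathbb{L}$; where $A$ is a constant with $A^3=-1$ and $A\tau\in\mathbb{L}$ for every period $\tau$ of $\wp$.
   Context: Meromorphic and entire functions are on the whole complex plane $\mathbb{C}$, and $f^3(z)$ means $(f(z))^3$. $\wp$ denotes the Weierstrass elliptic function $$\wp(z)=\frac1{z^2}+\sum_{\mu,\nu\in\mathbb{Z};\,\mu^2+\nu^2\neq0}\left\{\frac1{(z+\mu\omega_1+\nu\omega_2)^2}-\frac1{(\mu\omega_1+\nu\omega_2)^2}\right\}$$ with periods $\omega_1,\omega_2$ ($\operatorname{Im}(\omega_1/\omega_2)\neq0$) chosen so that $(\wp')^2=4\wp^3-1$. Its period lattice is $\mathbb{L}=\{\mu\omega_1+\nu\omega_2:\mu,\nu\in\mathbb{Z}\}$. In the period parallelogram $D$ with vertices $0,\omega_1,\omega_2,\omega_1+\omega_2$, $\wp$ has exactly two distinct zeros $\theta_1,\theta_2$, labelled so that $\wp'(\theta_1)=-i$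 and $\wp'(\theta_2)=i$. *)

theory Defs
  imports "HOL-Complex_Analysis.Complex_Analysis"
begin

definition period_lattice :: "complex \<Rightarrow> complex \<Rightarrow> complex set" where
  "period_lattice \<omega>\<^sub>1 \<omega>\<^sub>2 =
     {of_int \<mu> * \<omega>\<^sub>1 + of_int \<nu> * \<omega>\<^sub>2 | (\<mu> :: int) (\<nu> :: int). True}"

(* The closed parallelogram with vertices 0, \<omega>1, \<omega>2, \<omega>1 + \<omega>2. *)
definition period_parallelogram :: "complex \<Rightarrow> complex \<Rightarrow> complex set" where
  "period_parallelogram \<omega>\<^sub>1 \<omega>\<^sub>2 = convex hull {0, \<omega>\<^sub>1, \<omega>\<^sub>2, \<omega>\<^sub>1 + \<omega>\<^sub>2}"

(* The series converges absolutely, so the unordered sum is the usual one. At lattice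
   points, which are the poles, the value is an artefact of 1 / 0 = 0 (for example, the
   value at 0 is 0). *)
definition weierstrass_p :: "complex \<Rightarrow> complex \<Rightarrow> complex \<Rightarrow> complex" where
  "weierstrass_p \<omega>\<^sub>1 \<omega>\<^sub>2 z =
     1 / z ^ 2 +
     (\<Sum>\<^sub>\<infinity>(\<mu>, \<nu>) \<in> {(\<mu> :: int, \<nu> :: int). \<mu>\<^sup>2 + \<nu>\<^sup>2 \<noteq> 0}.
        1 / (z + of_int \<mu> * \<omega>\<^sub>1 + of_int \<nu> * \<omega>\<^sub>2) ^ 2
        - 1 / (of_int \<mu> * \<omega>\<^sub>1 + of_int \<nu> * \<omega>\<^sub>2) ^ 2)"

(* Library functions that are meromorphic_on a set may take arbitrary values on a sparse set,
   so identities between meromorphic functions are stated outside a sparse set. *)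
definition nonconstant_meromorphic :: "(complex \<Rightarrow> complex) \<Rightarrow> bool" where
  "nonconstant_meromorphic f \<longleftrightarrow>
     f meromorphic_on UNIV \<and> \<not> (\<exists>a. \<forall>\<^sub>\<approx>z\<in>UNIV. f z = a)"

definition nonconstant_entire :: "(complex \<Rightarrow> complex) \<Rightarrow> bool" where
  "nonconstant_entire h \<longleftrightarrow> h holomorphic_on UNIV \<and> \<not> h constant_on UNIV"

end

theory Submission
  imports Defs
begin

text \<open>
  The curve \<open>X^3 + Y^3 = 1\<close> is elliptic: \<open>x = 1 / (X + Y)\<close> and
  \<open>y = \<surd>3 (X - Y) / (X + Y)\<close> turn it into \<open>y^2 = 4 x^3 - 1\<close>, which \<open>(\<wp>, \<wp>')\<close> parametrises.
  Pulled back, the parametrisation is \<open>X = (1 + \<wp>' / \<surd>3) / (2 \<wp>)\<close> (\<open>fermat_x\<close>) and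
  \<open>Y w = X (- w)\<close> (\<open>fermat_y\<close>). In this language a solution \<open>f\<close> is a meromorphic map
  \<open>z \<mapsto> (f z, f (z + c))\<close> into the cubic, and the theorem describes how its lifts \<open>h\<close> to the
  universal cover behave under \<open>z \<mapsto> z + c\<close>.

  Lifts exist (\<open>fermat_lift\<close>) because the invariant differential \<open>dX / (\<surd>3 Y^2) = - dY / (\<surd>3 X^2)\<close>
  corresponds to \<open>dw\<close> and has no poles on the cubic, its points at infinity included, so that it pulls
  back to an entire function; \<open>h\<close> is a primitive of it. The constant of integration is chosen by the
  surjectivity of \<open>\<wp>\<close>, which is Liouville's theorem. Near one point \<open>h\<close> is the lift by inverting \<open>\<wp>\<close>
  locally, and the identity theorem does the rest. Two lifts of the same map differ by a period.

  The same theorem yields the automorphisms that are needed. For cube roots of unity \<open>\<alpha>, \<beta>\<close> the map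
  \<open>(\<alpha> X, \<beta> Y)\<close> again lies on the cubic, and its differential is \<open>\<alpha> \<beta> dw\<close>; so its lift is the
  affine map \<open>w \<mapsto> \<alpha> \<beta> w + b\<close> (\<open>fermat_scaling\<close>). Letting \<open>w\<close> tend to the pole at the origin shows
  that \<open>b\<close> is a period if \<open>\<alpha> = \<beta>\<close> and a zero of \<open>\<wp>\<close> otherwise (\<open>scaling_offset\<close>), hence congruent to
  \<open>\<theta>\<^sub>1\<close> or \<open>\<theta>\<^sub>2\<close> in the second case. Comparing periods on both sides shows that multiplication by \<open>\<alpha> \<beta>\<close>
  maps the lattice to itself.

  If \<open>f\<close> is a solution with lift \<open>h\<close>, then \<open>f (z + 2 c)^3 = f z^3\<close>, so \<open>f (z + 2 c) = \<eta> f z\<close> with a constant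
  cube root of unity \<open>\<eta>\<close>. Hence \<open>- h (z + c)\<close> lifts \<open>(\<eta> X, Y)\<close> along \<open>h\<close>, and so does \<open>\<eta> h z + b\<close>; this gives
  \<open>A = - \<eta>\<close> and the three cases. Conversely, \<open>\<theta>\<^sub>1\<close> and \<open>\<theta>\<^sub>2\<close> are periods of \<open>X^3\<close>: for a primitive cube
  root of unity \<open>\<zeta>\<close> the automorphism \<open>(\<zeta> X, \<zeta>^2 Y)\<close> is translation by a zero of \<open>\<wp>\<close>. Therefore
  \<open>X (A w + p)^3\<close> has the same value for all translations \<open>p\<close> allowed in the three cases, and for one of
  them it is visibly \<open>Y w^3 = 1 - X w^3\<close>.
\<close>

section \<open>Meromorphic and entire functions on the plane\<close>

lemma cosparse_UNIV_iff: "(\<forall>\<^sub>\<approx>z\<in>UNIV. P z) \<longleftrightarrow> (\<forall>z. eventually P (at z))"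
  by (simp add: eventually_cosparse_open_eq)

lemma cosparse_UNIV_open_ball:
  fixes P :: "complex \<Rightarrow> bool"
  assumes "\<forall>\<^sub>\<approx>z\<in>UNIV. P z"
  obtains z\<^sub>0 r where "r > 0" "\<And>z. z \<in> ball z\<^sub>0 r \<Longrightarrow> P z"
proof -
  have "closed {z. \<not> P z}"
    using assms unfolding eventually_cosparse by (rule sparse_in_UNIV_imp_closed)
  hence "open {z. P z}" by (simp add: closed_def Collect_neg_eq[symmetric])
  moreover obtain z\<^sub>0 where "P z\<^sub>0"
    using eventually_happens[OF assms] by auto
  ultimately obtain r where "r > 0" "ball z\<^sub>0 r \<subseteq> {z. P z}"
    by (metis mem_Collect_eq open_contains_ball)
  thus ?thesis by (intro that[of r z\<^sub>0]) auto
qed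

text \<open>The predicate leaves the values on a sparse set arbitrary, so the identity theorem
  concludes equality off a sparse set only.\<close>

lemma meromorphic_identity:
  assumes "f meromorphic_on UNIV" "g meromorphic_on UNIV" "eventually (\<lambda>z. f z = g z) (at z\<^sub>0)"
  shows "\<forall>\<^sub>\<approx>z\<in>UNIV. f z = g z"
proof -
  have "(\<lambda>z. f z - g z) meromorphic_on UNIV" by (intro meromorphic_intros assms)
  from meromorphic_imp_constant_or_avoid[OF this open_UNIV connected_UNIV, of 0]
  show ?thesis
  proof
    assume "\<forall>\<^sub>\<approx>z\<in>UNIV. f z - g z \<noteq> 0"
    hence "eventually (\<lambda>z. f z - g z \<noteq> 0) (at z\<^sub>0)" by (simp add: cosparse_UNIV_iff)
    with assms(3) have "eventually (\<lambda>_. False) (at z\<^sub>0)" by eventually_elim simp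
    thus ?thesis by simp
  qed simp
qed

lemma entire_identity:
  fixes f g :: "complex \<Rightarrow> complex"
  assumes "f holomorphic_on UNIV" "g holomorphic_on UNIV" "\<forall>\<^sub>\<approx>z\<in>UNIV. f z = g z"
  shows "f z = g z"
proof -
  have "continuous_on UNIV f" "continuous_on UNIV g"
    using assms holomorphic_on_imp_continuous_on by blast+
  hence f: "f \<midarrow>z\<rightarrow> f z" and g: "g \<midarrow>z\<rightarrow> g z"
    by (auto simp: continuous_on_eq_continuous_at isCont_def)
  have "eventually (\<lambda>z. f z = g z) (at z)" using assms(3) by (simp add: cosparse_UNIV_iff)
  from LIM_unique[OF Lim_transform_eventually[OF f this] g] show ?thesis .
qed

lemma nonconstant_entire_avoids:
  assumes "nonconstant_entire h"
  shows "\<forall>\<^sub>\<approx>z\<in>UNIV. h z \<noteq> a"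
proof -
  have h: "h holomorphic_on UNIV" "\<not> h constant_on UNIV"
    using assms by (auto simp: nonconstant_entire_def)
  have "h nicely_meromorphic_on UNIV"
    using h by (intro analytic_on_imp_nicely_meromorphic_on) (simp add: analytic_on_open)
  from nicely_meromorphic_imp_constant_or_avoid[OF this open_UNIV connected_UNIV, of a] h(2)
  show ?thesis by (auto simp: constant_on_def)
qed

text \<open>The fibres of a nonconstant entire map are discrete, so preimages of sparse sets are sparse.\<close>

lemma cosparse_compose_entire:
  assumes "nonconstant_entire h" "\<forall>\<^sub>\<approx>w\<in>UNIV. P w"
  shows "\<forall>\<^sub>\<approx>z\<in>UNIV. P (h z)"
  unfolding cosparse_UNIV_iff
proof
  fix z
  have "isCont h z"
    using assms(1) holomorphic_on_imp_continuous_on[of h UNIV]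
    by (auto simp: nonconstant_entire_def continuous_on_eq_continuous_at)
  moreover have "eventually (\<lambda>w. h w \<noteq> h z) (at z)"
    using nonconstant_entire_avoids[OF assms(1), of "h z"] by (simp add: cosparse_UNIV_iff)
  ultimately have "filterlim h (at (h z)) (at z)"
    by (intro filterlim_atI) (auto simp: isCont_def)
  moreover have "eventually P (at (h z))" using assms(2) by (simp add: cosparse_UNIV_iff)
  ultimately show "eventually (\<lambda>z. P (h z)) (at z)"
    using eventually_compose_filterlim by blast
qed

lemma nonconstant_entire_affine:
  assumes "a \<noteq> 0"
  shows "nonconstant_entire (\<lambda>z. a * z + b)"
proof -
  have "a * 0 + b \<noteq> a * 1 + b" using assms by simp
  hence "\<not> (\<lambda>z. a * z + b) constant_on UNIV" unfolding constant_on_def by (metis UNIV_I)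
  thus ?thesis by (auto simp: nonconstant_entire_def intro!: holomorphic_intros)
qed

lemma nonconstant_entire_shift: "nonconstant_entire (\<lambda>z. z + b)"
  using nonconstant_entire_affine[of 1 b] by simp

lemma meromorphic_compose_entire:
  assumes "f meromorphic_on UNIV" "h holomorphic_on UNIV"
  shows "(\<lambda>z. f (h z)) meromorphic_on UNIV"
  by (rule meromorphic_on_compose[OF assms(1)]) (use assms(2) in \<open>auto simp: analytic_on_open\<close>)

lemma meromorphic_entire_extension:
  assumes "k meromorphic_on UNIV"
    and "\<And>z. \<exists>l. k \<midarrow>z\<rightarrow> l"
  shows "remove_sings k holomorphic_on UNIV" "\<forall>\<^sub>\<approx>z\<in>UNIV. remove_sings k z = k z"
proof -
  have "remove_sings k analytic_on {z}" for z
    using assms(2)[of z] meromorphic_on_isolated_singularity[OF meromorphic_on_subset[OF assms(1)]]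
    by (auto intro: remove_sings_analytic_at)
  hence "remove_sings k analytic_on UNIV" using analytic_on_analytic_at by blast
  thus "remove_sings k holomorphic_on UNIV" by (simp add: analytic_on_open)
  show "\<forall>\<^sub>\<approx>z\<in>UNIV. remove_sings k z = k z"
    by (rule eventually_remove_sings_eq) fact
qed

lemma eventually_at_eventually_nhds:
  fixes z :: complex
  assumes "eventually P (at z)"
  shows "eventually (\<lambda>w. eventually P (nhds w)) (at z)"
proof -
  obtain S where S: "open S" "z \<in> S" "\<And>x. x \<in> S \<Longrightarrow> x \<noteq> z \<Longrightarrow> P x"
    using assms by (auto simp: eventually_at_topological)
  have "eventually P (nhds w)" if "w \<in> S" "w \<noteq> z" for w
    unfolding eventually_nhds
    by (rule exI[of _ "S - {z}"]) (use S that in \<open>auto intro: open_delete\<close>)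
  thus ?thesis using S by (auto simp: eventually_at_topological)
qed

lemma eventually_at_deriv_cong:
  fixes f g :: "complex \<Rightarrow> complex"
  assumes "eventually (\<lambda>w. f w = g w) (at z)"
  shows "eventually (\<lambda>w. deriv f w = deriv g w) (at z)"
  using eventually_at_eventually_nhds[OF assms]
  by eventually_elim (auto intro: deriv_cong_ev)

lemma eventually_analytic_at:
  assumes "f analytic_on {z}"
  shows "eventually (\<lambda>w. f analytic_on {w}) (at z)"
proof -
  obtain S where "open S" "z \<in> S" "f holomorphic_on S" using assms analytic_at by blast
  thus ?thesis by (auto simp: eventually_at_topological analytic_at)
qed

text \<open>A meromorphic function takes each single value either almost everywhere or almost nowhere.
  Finitely many sparse sets cannot cover the plane.\<close>

lemma meromorphic_finite_range_constant:
  assumes "f meromorphic_on UNIV" "finite S" "\<forall>\<^sub>\<approx>z\<in>UNIV. f z \<in> S"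
  shows "\<exists>c\<in>S. \<forall>\<^sub>\<approx>z\<in>UNIV. f z = c"
proof (rule ccontr)
  assume "\<not> (\<exists>c\<in>S. \<forall>\<^sub>\<approx>z\<in>UNIV. f z = c)"
  hence "\<forall>c\<in>S. \<forall>\<^sub>\<approx>z\<in>UNIV. f z \<noteq> c"
    using meromorphic_imp_constant_or_avoid[OF assms(1) open_UNIV connected_UNIV] by blast
  hence "\<forall>\<^sub>\<approx>z\<in>UNIV. \<forall>c\<in>S. f z \<noteq> c"
    using assms(2) by (simp add: eventually_ball_finite_distrib)
  with assms(3) have "eventually (\<lambda>_. False) (cosparse (UNIV :: complex set))"
    by eventually_elim auto
  thus False by simp
qed

lemma meromorphic_cube_constant:
  assumes "f meromorphic_on UNIV" "\<forall>\<^sub>\<approx>z\<in>UNIV. f z ^ 3 = a"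
  shows "\<exists>c. c ^ 3 = a \<and> (\<forall>\<^sub>\<approx>z\<in>UNIV. f z = c)"
proof -
  have "finite {c :: complex. c ^ 3 = a}" by (rule finite_nth_roots) simp
  moreover have "\<forall>\<^sub>\<approx>z\<in>UNIV. f z \<in> {c. c ^ 3 = a}" using assms(2) by simp
  ultimately show ?thesis using meromorphic_finite_range_constant[OF assms(1)] by blast
qed

lemma tendsto_analytic: "f analytic_on {z} \<Longrightarrow> f \<midarrow>z\<rightarrow> f z"
  using analytic_at_imp_isCont isCont_def by blast

text \<open>At a pole of \<open>v\<close> the cube would tend to infinity as well.\<close>

lemma remove_sings_analytic_of_cube_limit:
  assumes "v meromorphic_on UNIV" "eventually (\<lambda>w. v w ^ 3 = p w) (at z)" "p \<midarrow>z\<rightarrow> l"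
  shows "remove_sings v analytic_on {z}" "remove_sings v z ^ 3 = l"
proof -
  have iso: "isolated_singularity_at v z" "not_essential v z"
    using meromorphic_on_isolated_singularity[OF meromorphic_on_subset[OF assms(1)]]
      meromorphic_on_not_essential[OF meromorphic_on_subset[OF assms(1)]] by blast+
  have "\<not> is_pole v z"
  proof
    assume "is_pole v z"
    hence "filterlim (\<lambda>w. v w ^ 3) at_infinity (at z)"
      unfolding is_pole_def by (rule Limits.filterlim_power_at_infinity) simp
    moreover have "((\<lambda>w. v w ^ 3) \<longlongrightarrow> l) (at z)"
      using tendsto_cong[OF assms(2)] assms(3) by blast
    ultimately show False using not_tendsto_and_filterlim_at_infinity by (metis at_neq_bot)
  qed
  then obtain c where c: "v \<midarrow>z\<rightarrow> c" using iso(2) by (auto simp: not_essential_def is_pole_def)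
  show "remove_sings v analytic_on {z}" by (rule remove_sings_analytic_at[OF iso(1) c])
  have "((\<lambda>w. v w ^ 3) \<longlongrightarrow> c ^ 3) (at z)" using c by (intro tendsto_intros)
  moreover have "((\<lambda>w. v w ^ 3) \<longlongrightarrow> l) (at z)"
    using tendsto_cong[OF assms(2)] assms(3) by blast
  ultimately have "c ^ 3 = l" using LIM_unique by blast
  moreover have "remove_sings v z = c" using c by auto
  ultimately show "remove_sings v z ^ 3 = l" by simp
qed

lemma tendsto_zero_of_square:
  fixes f :: "complex \<Rightarrow> complex"
  assumes "((\<lambda>w. f w ^ 2) \<longlongrightarrow> 0) F"
  shows "(f \<longlongrightarrow> 0) F"
proof -
  have "((\<lambda>w. norm (f w) ^ 2) \<longlongrightarrow> 0) F"
    using tendsto_norm_zero[OF assms] by (simp add: norm_power)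
  hence "((\<lambda>w. norm (f w)) \<longlongrightarrow> 0) F" by (simp add: power_tendsto_0_iff)
  thus ?thesis by (rule tendsto_norm_zero_cancel)
qed

section \<open>Lattices in the plane\<close>

lemma summable_on_int_powr:
  "(\<lambda>m::int. (1 + \<bar>real_of_int m\<bar>) powr (-3/2)) summable_on UNIV"
proof -
  have s: "(\<lambda>n::nat. (1 + real n) powr (-3/2)) summable_on UNIV"
  proof (rule norm_summable_imp_summable_on)
    have "summable (\<lambda>n. real (Suc n) powr (-3/2))"
      by (subst summable_Suc_iff) (simp add: summable_real_powr_iff)
    thus "summable (\<lambda>n::nat. norm ((1 + real n) powr (-3/2)))" by (simp add: add.commute)
  qed
  have 1: "(\<lambda>m::int. (1 + \<bar>real_of_int m\<bar>) powr (-3/2)) summable_on range int"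
    by (subst summable_on_reindex) (use s in \<open>auto simp: o_def\<close>)
  have 2: "(\<lambda>m::int. (1 + \<bar>real_of_int m\<bar>) powr (-3/2)) summable_on range (\<lambda>n. - int n)"
    by (subst summable_on_reindex) (use s in \<open>auto simp: o_def inj_on_def\<close>)
  have "(\<lambda>m::int. (1 + \<bar>real_of_int m\<bar>) powr (-3/2)) summable_on range (\<lambda>n. - int n) - range int"
    using 2 by (rule summable_on_subset_banach) auto
  from summable_on_Un_disjoint[OF 1 this]
  have "(\<lambda>m::int. (1 + \<bar>real_of_int m\<bar>) powr (-3/2)) summable_on range int \<union> (range (\<lambda>n. - int n) - range int)"
    by auto
  also have "range int \<union> (range (\<lambda>n. - int n) - range int) = UNIV"
    by (auto simp: image_iff) (metis int_cases2)
  finally show ?thesis .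
qed

text \<open>A summable majorant on pairs of integers in product form: no summation over shells of
  lattice points is needed.\<close>

lemma summable_on_int_prod_powr:
  "(\<lambda>(m::int, n::int). (1 + \<bar>real_of_int m\<bar>) powr (-3/2) * (1 + \<bar>real_of_int n\<bar>) powr (-3/2))
     summable_on UNIV"
proof -
  let ?a = "\<lambda>m::int. (1 + \<bar>real_of_int m\<bar>) powr (-3/2)"
  have "Infinite_Sum.abs_summable_on (\<lambda>(m, n). ?a m * ?a n) (UNIV \<times> UNIV)"
    unfolding Infinite_Sum.abs_summable_on_Sigma_iff
    using summable_on_int_powr
    by (auto simp: abs_mult infsum_cmult_right' intro!: summable_on_cmult_right summable_on_cmult_left)
  from abs_summable_summable[OF this] show ?thesis by simp
qed

locale complex_lattice =
  fixes \<omega>\<^sub>1 \<omega>\<^sub>2 :: complex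
  assumes indep: "Im (\<omega>\<^sub>1 / \<omega>\<^sub>2) \<noteq> 0"
begin

definition lat :: "int \<times> int \<Rightarrow> complex" where
  "lat p = of_int (fst p) * \<omega>\<^sub>1 + of_int (snd p) * \<omega>\<^sub>2"

abbreviation L :: "complex set" where "L \<equiv> period_lattice \<omega>\<^sub>1 \<omega>\<^sub>2"

lemma L_eq: "L = range lat"
  by (force simp: period_lattice_def lat_def image_iff)

lemma lat_add: "lat (p + q) = lat p + lat q"
  and lat_minus: "lat (- p) = - lat p"
  and lat_zero [simp]: "lat 0 = 0"
  by (simp_all add: lat_def algebra_simps)

lemma L_0 [simp]: "0 \<in> L"
  by (metis L_eq lat_zero rangeI)

lemma L_add: "a \<in> L \<Longrightarrow> b \<in> L \<Longrightarrow> a + b \<in> L"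
  by (auto simp: L_eq) (metis lat_add rangeI)

lemma L_minus: "a \<in> L \<Longrightarrow> - a \<in> L"
  by (auto simp: L_eq) (metis lat_minus rangeI)

lemma L_diff: "a \<in> L \<Longrightarrow> b \<in> L \<Longrightarrow> a - b \<in> L"
  using L_add[of a "- b"] L_minus[of b] by simp

lemma L_minus_iff [simp]: "- a \<in> L \<longleftrightarrow> a \<in> L"
  using L_minus[of a] L_minus[of "- a"] by auto

lemma L_add_iff: "b \<in> L \<Longrightarrow> a + b \<in> L \<longleftrightarrow> a \<in> L"
  using L_add[of a b] L_diff[of "a + b" b] by auto

text \<open>Division by \<open>\<omega>\<^sub>2\<close> makes the imaginary part of a lattice point a multiple of its first coordinate.\<close>

lemma lat_bound:
  obtains C where "C > 0" "\<And>p. \<bar>real_of_int (fst p)\<bar> \<le> C * norm (lat p)"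
    "\<And>p. \<bar>real_of_int (snd p)\<bar> \<le> C * norm (lat p)"
proof -
  define \<rho> where "\<rho> = \<omega>\<^sub>1 / \<omega>\<^sub>2"
  have w2: "\<omega>\<^sub>2 \<noteq> 0" using indep by auto
  have im: "\<bar>Im \<rho>\<bar> > 0" using indep by (auto simp: \<rho>_def)
  define A where "A = 1 / (norm \<omega>\<^sub>2 * \<bar>Im \<rho>\<bar>)"
  define B where "B = 1 / norm \<omega>\<^sub>2 + A * norm \<rho>"
  have A: "A > 0" using w2 im by (simp add: A_def)
  have B: "B > 0" using w2 A by (auto simp: B_def intro!: add_pos_nonneg)
  have lat_div: "lat p / \<omega>\<^sub>2 = of_int (fst p) * \<rho> + of_int (snd p)" for p
    using w2 by (simp add: lat_def \<rho>_def field_simps)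
  have 1: "\<bar>real_of_int (fst p)\<bar> \<le> A * norm (lat p)" for p
  proof -
    have "\<bar>real_of_int (fst p)\<bar> * \<bar>Im \<rho>\<bar> = \<bar>Im (lat p / \<omega>\<^sub>2)\<bar>"
      by (simp add: lat_div abs_mult)
    also have "\<dots> \<le> norm (lat p) / norm \<omega>\<^sub>2"
      using abs_Im_le_cmod[of "lat p / \<omega>\<^sub>2"] by (simp add: norm_divide)
    finally show ?thesis using im w2 by (simp add: A_def field_simps)
  qed
  have 2: "\<bar>real_of_int (snd p)\<bar> \<le> B * norm (lat p)" for p
  proof -
    have "\<bar>real_of_int (snd p)\<bar> = norm (lat p / \<omega>\<^sub>2 - of_int (fst p) * \<rho>)"
      by (simp add: lat_div)
    also have "\<dots> \<le> norm (lat p) / norm \<omega>\<^sub>2 + \<bar>real_of_int (fst p)\<bar> * norm \<rho>"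
      by (rule order_trans[OF norm_triangle_ineq4]) (simp add: norm_divide norm_mult)
    also have "\<dots> \<le> norm (lat p) / norm \<omega>\<^sub>2 + A * norm (lat p) * norm \<rho>"
      using 1[of p] by (intro add_mono mult_right_mono) auto
    finally show ?thesis by (simp add: B_def algebra_simps)
  qed
  show ?thesis
  proof (rule that[of "max A B"])
    show "\<bar>real_of_int (fst p)\<bar> \<le> max A B * norm (lat p)" for p
      by (rule order_trans[OF 1]) (intro mult_right_mono, auto)
    show "\<bar>real_of_int (snd p)\<bar> \<le> max A B * norm (lat p)" for p
      by (rule order_trans[OF 2]) (intro mult_right_mono, auto)
  qed (use A in auto)
qed

lemma lat_discrete:
  obtains m where "m > 0" "\<And>p. p \<noteq> 0 \<Longrightarrow> m \<le> norm (lat p)"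
proof -
  obtain C where C: "C > 0" "\<And>p. \<bar>real_of_int (fst p)\<bar> \<le> C * norm (lat p)"
    "\<And>p. \<bar>real_of_int (snd p)\<bar> \<le> C * norm (lat p)"
    using lat_bound by blast
  have "1 / C \<le> norm (lat p)" if "p \<noteq> 0" for p
  proof -
    have "fst p \<noteq> 0 \<or> snd p \<noteq> 0" using that by (auto simp: prod_eq_iff)
    hence "\<bar>real_of_int (fst p)\<bar> \<ge> 1 \<or> \<bar>real_of_int (snd p)\<bar> \<ge> 1" by linarith
    hence "1 \<le> C * norm (lat p)" using C(2,3)[of p] by linarith
    thus ?thesis using C(1) by (simp add: field_simps)
  qed
  thus ?thesis using C(1) by (intro that[of "1 / C"]) auto
qed

lemma lat_eq_0_iff [simp]: "lat p = 0 \<longleftrightarrow> p = 0"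
proof
  assume "lat p = 0"
  obtain m where m: "m > 0" "\<And>p. p \<noteq> 0 \<Longrightarrow> m \<le> norm (lat p)"
    using lat_discrete by blast
  show "p = 0" using m(1) m(2)[of p] \<open>lat p = 0\<close> by force
qed simp

lemma L_discrete:
  obtains m where "m > 0" "\<And>a. a \<in> L \<Longrightarrow> a \<noteq> 0 \<Longrightarrow> m \<le> norm a"
proof -
  obtain m where m: "m > 0" "\<And>p. p \<noteq> 0 \<Longrightarrow> m \<le> norm (lat p)"
    using lat_discrete by blast
  show ?thesis
    by (rule that[of m]) (use m in \<open>auto simp: L_eq\<close>)
qed

lemma closed_subset_L:
  assumes "S \<subseteq> L"
  shows "closed S"
proof -
  obtain m where m: "m > 0" "\<And>a. a \<in> L \<Longrightarrow> a \<noteq> 0 \<Longrightarrow> m \<le> norm a"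
    using L_discrete by blast
  show ?thesis
  proof (rule discrete_imp_closed[OF m(1)], safe)
    fix x y assume "x \<in> S" "y \<in> S" "dist y x < m"
    thus "y = x" using m(2)[of "y - x"] L_diff[of y x] assms by (force simp: dist_norm)
  qed
qed

lemma sparse_L: "L sparse_in UNIV"
proof -
  have "\<not> z islimpt L" for z
    using closed_subset_L[of "L - {z}"] unfolding islimpt_punctured[of z L] closed_limpt by blast
  thus ?thesis by (simp add: sparse_in_open)
qed

lemma countable_L: "countable L"
  by (simp add: L_eq)

lemma open_compl_L: "open (- L)"
  using closed_subset_L[of L] by auto

lemma connected_compl_L: "connected (- L)"
  unfolding Compl_eq_Diff_UNIV
  by (rule connected_open_diff_countable) (auto simp: countable_L connected_UNIV)

text \<open>The larger coordinate \<open>M\<close> of \<open>p = (m, n)\<close> is bounded by a multiple of \<open>|lat p|\<close>, and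
  \<open>(1 + |m|) (1 + |n|) \<le> 4 M^2\<close>. Hence the \<open>3/2\<close>-th power of the left hand side is bounded by a multiple of
  \<open>|lat p|^3\<close>. The origin contributes \<open>1 / 0 = 0\<close>.\<close>

lemma summable_lat_cube: "(\<lambda>p. 1 / norm (lat p) ^ 3) summable_on UNIV"
proof -
  obtain C where C: "C > 0" "\<And>p. \<bar>real_of_int (fst p)\<bar> \<le> C * norm (lat p)"
    "\<And>p. \<bar>real_of_int (snd p)\<bar> \<le> C * norm (lat p)"
    using lat_bound by blast
  let ?a = "\<lambda>m::int. (1 + \<bar>real_of_int m\<bar>) powr (-3/2)"
  have le: "1 / norm (lat p) ^ 3 \<le> 8 * C ^ 3 * (?a (fst p) * ?a (snd p))" for p
  proof (cases "p = 0")
    case False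
    define s where "s = 1 + \<bar>real_of_int (fst p)\<bar>"
    define t where "t = 1 + \<bar>real_of_int (snd p)\<bar>"
    have st: "s \<ge> 1" "t \<ge> 1" by (auto simp: s_def t_def)
    have "fst p \<noteq> 0 \<or> snd p \<noteq> 0" using False by (auto simp: prod_eq_iff)
    hence "\<bar>real_of_int (fst p)\<bar> \<ge> 1 \<or> \<bar>real_of_int (snd p)\<bar> \<ge> 1" by linarith
    hence c1: "1 \<le> C * norm (lat p)" using C(2,3)[of p] by linarith
    have s: "s \<le> 2 * C * norm (lat p)" and t: "t \<le> 2 * C * norm (lat p)"
      using c1 C(2,3)[of p] unfolding s_def t_def by linarith+
    have pos: "norm (lat p) > 0" using False by simp
    have "s * t \<le> (2 * C * norm (lat p)) ^ 2"
      unfolding power2_eq_square by (rule mult_mono[OF s t]) (use st s in auto)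
    hence "(s * t) powr (3/2) \<le> ((2 * C * norm (lat p)) ^ 2) powr (3/2)"
      using st by (intro powr_mono2) auto
    also have "((2 * C * norm (lat p)) ^ 2) powr (3/2) = ((2 * C * norm (lat p)) powr 2) powr (3/2)"
      using C(1) pos by simp
    also have "\<dots> = (2 * C * norm (lat p)) powr 3"
      by (subst powr_powr) simp
    also have "\<dots> = (2 * C * norm (lat p)) ^ 3"
      using C(1) pos by simp
    also have "\<dots> = 8 * C ^ 3 * norm (lat p) ^ 3"
      by (simp add: power_mult_distrib)
    finally have le: "s powr (3/2) * t powr (3/2) \<le> 8 * C ^ 3 * norm (lat p) ^ 3"
      using st by (simp add: powr_mult)
    define u where "u = s powr (3/2) * t powr (3/2)"
    have u: "u > 0" using st by (auto simp: u_def)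
    have "1 / norm (lat p) ^ 3 \<le> 8 * C ^ 3 * (1 / u)"
      using le u pos unfolding u_def[symmetric] by (simp add: field_simps)
    also have "1 / u = ?a (fst p) * ?a (snd p)"
      unfolding u_def s_def t_def by (simp add: powr_minus_divide)
    finally show ?thesis .
  qed (use C in auto)
  have "(\<lambda>p. 8 * C ^ 3 * (?a (fst p) * ?a (snd p))) summable_on UNIV"
    using summable_on_int_prod_powr by (intro summable_on_cmult_right) (simp add: case_prod_unfold)
  thus ?thesis
    by (rule summable_on_comparison_test) (use le in auto)
qed

section \<open>The Weierstrass function of a lattice\<close>

text \<open>At \<open>p = 0\<close> the value is \<open>1 / z^2\<close>, since \<open>1 / 0 = 0\<close>. Hence the principal part is one of the
  terms, and sums over all pairs of integers can be shifted by a period.\<close>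

definition wp_term :: "int \<times> int \<Rightarrow> complex \<Rightarrow> complex" where
  "wp_term p z = 1 / (z + lat p) ^ 2 - 1 / lat p ^ 2"

text \<open>The difference of the two fractions is of order \<open>|lat p|^(-3)\<close>, uniformly for bounded \<open>z\<close> that
  keep the distance \<open>\<delta>\<close> from the poles.\<close>

lemma wp_term_bound:
  assumes "\<delta> > 0"
  obtains M where "M summable_on UNIV"
    "\<And>p z. norm z \<le> R \<Longrightarrow> \<delta> \<le> norm (z + lat p) \<Longrightarrow> norm (wp_term p z) \<le> M p"
proof -
  obtain m where m: "m > 0" "\<And>p. p \<noteq> 0 \<Longrightarrow> m \<le> norm (lat p)"
    using lat_discrete by blast
  define R' where "R' = max R 1"
  have R': "R' \<ge> 1" "R \<le> R'" by (auto simp: R'_def)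
  \<comment> \<open>For \<open>|lat p| \<ge> 2 R'\<close> the triangle inequality gives \<open>|z + lat p| \<ge> |lat p| / 2\<close>, and otherwise the
    distance \<open>\<delta>\<close> is at least \<open>\<delta> / (2 R')\<close> times \<open>|lat p|\<close>.\<close>
  define e where "e = min (1/2) (\<delta> / (2 * R'))"
  have e: "e > 0" using assms R' by (auto simp: e_def)
  define K where "K = R' * (2 + R' / m) / e ^ 2"
  define M where "M = (\<lambda>p. K * (1 / norm (lat p) ^ 3) + (if p = 0 then 1 / \<delta> ^ 2 else 0))"
  have "(\<lambda>p::int\<times>int. if p = 0 then 1 / \<delta> ^ 2 else 0) summable_on UNIV \<longleftrightarrow>
      (\<lambda>p::int\<times>int. if p = 0 then 1 / \<delta> ^ 2 else 0) summable_on {0}"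
    by (rule summable_on_cong_neutral) auto
  hence "M summable_on UNIV"
    unfolding M_def by (intro summable_on_add summable_on_cmult_right summable_lat_cube) simp
  moreover have "norm (wp_term p z) \<le> M p" if z: "norm z \<le> R" "\<delta> \<le> norm (z + lat p)" for p z
  proof (cases "p = 0")
    case True
    have "1 / norm z ^ 2 \<le> 1 / \<delta> ^ 2"
      using True z assms by (intro divide_left_mono power_mono mult_pos_pos) auto
    thus ?thesis using True by (simp add: M_def wp_term_def norm_divide norm_power)
  next
    case False
    define l where "l = lat p"
    have l: "norm l \<ge> m" "l \<noteq> 0" "norm l > 0" using m(2)[of p] False by (auto simp: l_def)
    have zl: "z + l \<noteq> 0" using z assms by (auto simp: l_def)
    have zR: "norm z \<le> R'" using z R' by linarith
    have low: "e * norm l \<le> norm (z + l)"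
    proof (cases "norm l \<ge> 2 * R'")
      case True
      have "norm l - norm z \<le> norm (z + l)"
        using norm_diff_ineq[of l z] by (simp add: add.commute)
      hence "norm l / 2 \<le> norm (z + l)" using zR True by linarith
      moreover have "e * norm l \<le> 1/2 * norm l" by (intro mult_right_mono) (auto simp: e_def)
      ultimately show ?thesis by linarith
    next
      case False
      have "e * norm l \<le> \<delta> / (2 * R') * (2 * R')"
        using False assms R' by (intro mult_mono) (auto simp: e_def)
      thus ?thesis using z R' by (simp add: l_def)
    qed
    have "wp_term p z = - (z * (2 * l + z)) / (l ^ 2 * (z + l) ^ 2)"
      using l zl unfolding wp_term_def l_def[symmetric]
      by (simp add: divide_simps) (simp add: power2_eq_square algebra_simps)
    hence "norm (wp_term p z) = norm z * norm (2 * l + z) / (norm l ^ 2 * norm (z + l) ^ 2)"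
      by (simp add: norm_divide norm_mult norm_power)
    also have "\<dots> \<le> R' * (2 * norm l + R' / m * norm l) / (norm l ^ 2 * (e * norm l) ^ 2)"
    proof (intro frac_le mult_mono power_mono)
      have "R' \<le> R' / m * norm l" using l m R' by (simp add: field_simps)
      thus "norm (2 * l + z) \<le> 2 * norm l + R' / m * norm l"
        using norm_triangle_ineq[of "2 * l" z] zR by (simp add: norm_mult)
    qed (use R' m l e zR low in auto)
    also have "\<dots> = K * (1 / norm l ^ 3)"
      using l(3) e m(1) unfolding K_def
      by (simp add: field_simps power2_eq_square power3_eq_cube)
    finally show ?thesis using False by (simp add: M_def l_def)
  qed
  ultimately show ?thesis using that by blast
qed

text \<open>The series may be differentiated termwise where its terms are regular. The index set is
  arbitrary because two cases are needed: all indices, for points off the lattice, and all indices except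
  \<open>0\<close>, for the regular part at the origin.\<close>

lemma infsum_wp_term_deriv:
  fixes I :: "(int \<times> int) set"
  assumes "\<And>p. p \<in> I \<Longrightarrow> z + lat p \<noteq> 0"
  obtains D where "((\<lambda>w. \<Sum>\<^sub>\<infinity>p\<in>I. wp_term p w) has_field_derivative D) (at z)"
    "((\<lambda>p. - 2 / (z + lat p) ^ 3) has_sum D) I" "(\<lambda>p. wp_term p z) summable_on I"
proof -
  have "closed (lat ` I)" by (rule closed_subset_L) (auto simp: L_eq)
  moreover have "- z \<notin> lat ` I" using assms by (metis imageE add.right_inverse)
  ultimately obtain d where d: "d > 0" "ball (- z) d \<subseteq> - lat ` I"
    by (metis ComplI open_Compl open_contains_ball)
  define r where "r = d / 2"
  have low: "r \<le> norm (w + lat p)" if "w \<in> cball z r" "p \<in> I" for w p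
  proof -
    have "lat p \<notin> ball (- z) d" using d that by auto
    moreover have "dist (- z) (lat p) = norm (z + lat p)"
      using norm_minus_cancel[of "z + lat p"] by (simp add: dist_norm)
    ultimately have "d \<le> norm (z + lat p)" by simp
    also have "\<dots> \<le> norm (w + lat p) + norm (z - w)"
      using norm_triangle_ineq[of "w + lat p" "z - w"] by (simp add: algebra_simps)
    finally show ?thesis using that by (simp add: r_def dist_norm)
  qed
  have r: "r > 0" using d by (simp add: r_def)
  obtain M where M: "M summable_on UNIV"
    "\<And>p w. norm w \<le> norm z + r \<Longrightarrow> r \<le> norm (w + lat p) \<Longrightarrow> norm (wp_term p w) \<le> M p"
    using wp_term_bound[OF r] by blast
  have bd: "norm (wp_term p w) \<le> M p" if "p \<in> I" "w \<in> cball z r" for p w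
  proof (rule M(2)[OF _ low[OF that(2,1)]])
    show "norm w \<le> norm z + r"
      using that norm_triangle_ineq[of z "w - z"] by (simp add: dist_norm norm_minus_commute)
  qed
  have MI: "M summable_on I" using M(1) by (rule summable_on_subset_banach) auto
  have ulim: "uniform_limit (cball z r) (\<lambda>X w. \<Sum>p\<in>X. wp_term p w)
      (\<lambda>w. \<Sum>\<^sub>\<infinity>p\<in>I. wp_term p w) (finite_subsets_at_top I)"
    using bd MI by (rule Weierstrass_m_test_general)
  have term_deriv: "((wp_term p) has_field_derivative (- 2 / (w + lat p) ^ 3)) (at w)"
    if "w \<in> cball z r" "p \<in> I" for w p
  proof -
    have nz: "w + lat p \<noteq> 0" using low[OF that] r by auto
    have "((\<lambda>w. (w + lat p) ^ 2) has_field_derivative 2 * (w + lat p)) (at w)"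
      by (auto intro!: derivative_eq_intros)
    from DERIV_inverse'[OF this] nz
    have "((\<lambda>w. inverse ((w + lat p) ^ 2) - 1 / lat p ^ 2) has_field_derivative
        - (inverse ((w + lat p) ^ 2) * (2 * (w + lat p)) * inverse ((w + lat p) ^ 2)) - 0) (at w)"
      by (intro DERIV_diff) auto
    also have "- (inverse ((w + lat p) ^ 2) * (2 * (w + lat p)) * inverse ((w + lat p) ^ 2)) - 0
        = - 2 / (w + lat p) ^ 3"
    proof -
      have "- (inverse (u ^ 2) * (2 * u) * inverse (u ^ 2)) - 0 = - 2 / u ^ 3" if "u \<noteq> 0" for u :: complex
        using that by (simp add: field_simps power2_eq_square power3_eq_cube)
      thus ?thesis using nz by blast
    qed
    finally have "((\<lambda>w. 1 / (w + lat p) ^ 2 - 1 / lat p ^ 2) has_field_derivative (- 2 / (w + lat p) ^ 3)) (at w)"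
      by (simp add: divide_inverse)
    thus ?thesis by (simp add: wp_term_def[abs_def])
  qed
  have "eventually (\<lambda>X. continuous_on (cball z r) (\<lambda>w. \<Sum>p\<in>X. wp_term p w) \<and>
     (\<forall>w\<in>ball z r. ((\<lambda>w. \<Sum>p\<in>X. wp_term p w) has_field_derivative
         (\<Sum>p\<in>X. - 2 / (w + lat p) ^ 3)) (at w))) (finite_subsets_at_top I)"
  proof (rule eventually_finite_subsets_at_top_weakI)
    fix X assume X: "finite X" "X \<subseteq> I"
    have *: "((\<lambda>w. \<Sum>p\<in>X. wp_term p w) has_field_derivative (\<Sum>p\<in>X. - 2 / (w + lat p) ^ 3)) (at w)"
      if "w \<in> cball z r" for w
      by (rule DERIV_sum) (use term_deriv that X in auto)
    have "continuous_on (cball z r) (\<lambda>w. \<Sum>p\<in>X. wp_term p w)"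
      by (rule continuous_at_imp_continuous_on) (use * DERIV_isCont in blast)
    thus "continuous_on (cball z r) (\<lambda>w. \<Sum>p\<in>X. wp_term p w) \<and>
     (\<forall>w\<in>ball z r. ((\<lambda>w. \<Sum>p\<in>X. wp_term p w) has_field_derivative
         (\<Sum>p\<in>X. - 2 / (w + lat p) ^ 3)) (at w))" using * by auto
  qed
  from has_complex_derivative_uniform_limit[OF this ulim finite_subsets_at_top_neq_bot r]
  obtain g' where g': "\<And>w. w \<in> ball z r \<Longrightarrow>
      ((\<lambda>w. \<Sum>\<^sub>\<infinity>p\<in>I. wp_term p w) has_field_derivative g' w) (at w) \<and>
      ((\<lambda>X. \<Sum>p\<in>X. - 2 / (w + lat p) ^ 3) \<longlongrightarrow> g' w) (finite_subsets_at_top I)"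
    by blast
  have "(\<lambda>p. wp_term p z) summable_on I"
    by (rule abs_summable_summable, rule summable_on_comparison_test[OF MI])
       (use bd r in auto)
  with g'[of z] r show ?thesis by (intro that) (auto simp: has_sum_def)
qed

abbreviation wp :: "complex \<Rightarrow> complex" where "wp \<equiv> weierstrass_p \<omega>\<^sub>1 \<omega>\<^sub>2"

abbreviation wp' :: "complex \<Rightarrow> complex" where "wp' \<equiv> deriv wp"

lemma add_lat_eq_0_iff: "z + lat p = 0 \<longleftrightarrow> z = lat (- p)"
  by (simp add: lat_minus eq_neg_iff_add_eq_0)

lemma add_lat_nonzero: "z \<notin> L \<Longrightarrow> z + lat p \<noteq> 0"
  by (auto simp: add_lat_eq_0_iff L_eq)

lemma wp_eq_punctured: "wp z = 1 / z ^ 2 + (\<Sum>\<^sub>\<infinity>p\<in>UNIV - {0}. wp_term p z)"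
proof -
  have *: "{(\<mu> :: int, \<nu> :: int). \<mu>\<^sup>2 + \<nu>\<^sup>2 \<noteq> 0} = UNIV - {0}"
    by (auto simp: sum_power2_eq_zero_iff zero_prod_def)
  show ?thesis
    unfolding weierstrass_p_def * by (simp add: wp_term_def lat_def case_prod_unfold add.assoc)
qed

lemma wp_eq:
  assumes "z \<notin> L"
  shows "wp z = (\<Sum>\<^sub>\<infinity>p. wp_term p z)"
proof -
  have "(\<lambda>p. wp_term p z) summable_on UNIV - {0}"
    using infsum_wp_term_deriv[of "UNIV - {0}" z] add_lat_nonzero[OF assms] by metis
  hence "(\<Sum>\<^sub>\<infinity>p\<in>insert 0 (UNIV - {0}). wp_term p z) = wp_term 0 z + (\<Sum>\<^sub>\<infinity>p\<in>UNIV - {0}. wp_term p z)"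
    by (intro infsum_insert) auto
  thus ?thesis by (simp add: wp_eq_punctured wp_term_def insert_UNIV)
qed

lemma wp_derivative_sum:
  assumes "z \<notin> L"
  shows "(wp has_field_derivative wp' z) (at z)"
    and "((\<lambda>p. - 2 / (z + lat p) ^ 3) has_sum wp' z) UNIV"
proof -
  obtain D where D: "((\<lambda>w. \<Sum>\<^sub>\<infinity>p. wp_term p w) has_field_derivative D) (at z)"
    "((\<lambda>p. - 2 / (z + lat p) ^ 3) has_sum D) UNIV"
    using infsum_wp_term_deriv[of UNIV z] add_lat_nonzero[OF assms] by metis
  have "(wp has_field_derivative D) (at z)"
  proof (rule has_field_derivative_transform_within_open[OF D(1) open_compl_L])
    show "(\<Sum>\<^sub>\<infinity>p. wp_term p w) = wp w" if "w \<in> - L" for w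
      using that by (simp add: wp_eq)
  qed (use assms in auto)
  moreover from this have "wp' z = D" by (rule DERIV_imp_deriv)
  ultimately show "(wp has_field_derivative wp' z) (at z)"
    and "((\<lambda>p. - 2 / (z + lat p) ^ 3) has_sum wp' z) UNIV" using D(2) by simp_all
qed

lemma wp_holomorphic: "wp holomorphic_on - L"
  using wp_derivative_sum(1) by (auto simp: holomorphic_on_open[OF open_compl_L])

lemma wp_even: "wp (- z) = wp z"
proof -
  have "(\<Sum>\<^sub>\<infinity>p\<in>UNIV - {0}. wp_term p (- z)) = (\<Sum>\<^sub>\<infinity>p\<in>UNIV - {0}. wp_term p z)"
  proof (rule infsum_reindex_bij_witness[of _ uminus uminus])
    show "wp_term (- p) z = wp_term p (- z)" for p
      using power2_minus[of "z - lat p"] by (simp add: wp_term_def lat_minus)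
  qed auto
  thus ?thesis by (simp add: wp_eq_punctured)
qed

lemma wp'_odd:
  assumes "z \<notin> L"
  shows "wp' (- z) = - wp' z"
proof -
  have "((\<lambda>z. wp (- z)) has_field_derivative wp' (- z) * (- 1)) (at z)"
    using assms wp_derivative_sum(1)[of "- z"]
    by (intro DERIV_chain2[of wp _ uminus]) (auto intro!: derivative_eq_intros)
  hence "(wp has_field_derivative - wp' (- z)) (at z)"
    by (simp add: wp_even)
  from DERIV_unique[OF this wp_derivative_sum(1)[OF assms]] show ?thesis
    by (metis minus_minus)
qed

text \<open>The termwise derivative runs over the whole index group, so a period only permutes its terms.\<close>

lemma wp'_periodic:
  assumes "z \<notin> L" "\<tau> \<in> L"
  shows "wp' (z + \<tau>) = wp' z"
proof -
  obtain q where q: "\<tau> = lat q" using assms by (auto simp: L_eq)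
  have "((\<lambda>p. - 2 / (z + \<tau> + lat p) ^ 3) has_sum wp' (z + \<tau>)) UNIV"
    using assms by (intro wp_derivative_sum(2)) (simp add: L_add_iff)
  hence "((\<lambda>p. - 2 / (z + lat (q + p)) ^ 3) has_sum wp' (z + \<tau>)) UNIV"
    by (simp add: q lat_add add.assoc)
  hence "((\<lambda>p. - 2 / (z + lat p) ^ 3) has_sum wp' (z + \<tau>)) UNIV"
    by (subst (asm) has_sum_reindex_bij_betw[where g = "\<lambda>p. q + p" and f = "\<lambda>p. - 2 / (z + lat p) ^ 3"])
       (auto intro: bij_plus_right)
  thus ?thesis using wp_derivative_sum(2)[OF assms(1)] has_sum_unique by blast
qed

text \<open>The difference \<open>\<wp> (z + \<tau>) - \<wp> z\<close> is a constant \<open>c\<close>, since its derivative vanishes and the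
  complement of the lattice is connected. Replacing \<open>z\<close> by \<open>- z\<close> and using that \<open>\<wp>\<close> is even gives \<open>c = - c\<close>.\<close>

lemma wp_periodic:
  assumes "z \<notin> L" "\<tau> \<in> L"
  shows "wp (z + \<tau>) = wp z"
proof -
  have "\<exists>c. \<forall>w\<in>- L. wp (w + \<tau>) - wp w = c"
  proof -
    have "((\<lambda>w. wp (w + \<tau>) - wp w) has_field_derivative 0) (at w)" if "w \<in> - L" for w
    proof -
      have "((\<lambda>w. wp (w + \<tau>)) has_field_derivative wp' w) (at w)"
        using that assms(2) wp_derivative_sum(1)[of "w + \<tau>"]
        by (subst DERIV_shift[symmetric]) (simp add: L_add_iff wp'_periodic)
      from DERIV_diff[OF this wp_derivative_sum(1)[of w]] that show ?thesis by simp
    qed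
    thus ?thesis
      using DERIV_zero_connected_constant[OF connected_compl_L open_compl_L, of "{}" "\<lambda>w. wp (w + \<tau>) - wp w"]
      by (metis (no_types, lifting) DERIV_isCont Diff_empty continuous_at_imp_continuous_on finite.emptyI)
  qed
  then obtain c where c: "\<And>w. w \<notin> L \<Longrightarrow> wp (w + \<tau>) - wp w = c" by auto
  have "wp (z - \<tau> + \<tau>) - wp (z - \<tau>) = c"
    using c[of "z - \<tau>"] assms L_add_iff[of \<tau> "z - \<tau>"] by simp
  moreover have "wp (- z + \<tau>) - wp (- z) = c" using c[of "- z"] assms by simp
  moreover have "wp (- z + \<tau>) = wp (z - \<tau>)" using wp_even[of "z - \<tau>"] by simp
  moreover have "(wp z - wp (z - \<tau>)) + (wp (z - \<tau>) - wp z) = 0" by simp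
  ultimately have "c + c = 0" by (simp add: wp_even)
  hence "c = 0" by (metis mult_2 mult_eq_0_iff zero_neq_numeral)
  thus ?thesis using c[OF assms(1)] by simp
qed

lemma eventually_notin_L: "eventually (\<lambda>w. w \<notin> L) (at z)"
  using sparse_L by (auto simp: sparse_in_eventually_iff)

lemma is_pole_wp:
  assumes "\<tau> \<in> L"
  shows "is_pole wp \<tau>"
proof -
  have "z + lat p \<noteq> 0" if "p \<in> UNIV - {0}" "z = 0" for p z using that by auto
  then obtain D where "((\<lambda>w. \<Sum>\<^sub>\<infinity>p\<in>UNIV - {0}. wp_term p w) has_field_derivative D) (at 0)"
    using infsum_wp_term_deriv[of "UNIV - {0}" 0] by metis
  hence "((\<lambda>w. \<Sum>\<^sub>\<infinity>p\<in>UNIV - {0}. wp_term p w) \<longlongrightarrow> (\<Sum>\<^sub>\<infinity>p\<in>UNIV - {0}. wp_term p 0)) (at 0)"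
    using DERIV_isCont isContD by fast
  moreover have "is_pole (\<lambda>w. 1 / (w - 0) ^ 2 :: complex) 0"
    by (rule is_pole_inverse_power) auto
  ultimately have "is_pole (\<lambda>w. (\<Sum>\<^sub>\<infinity>p\<in>UNIV - {0}. wp_term p w) + 1 / w ^ 2) 0"
    unfolding is_pole_def by (intro tendsto_add_filterlim_at_infinity) auto
  hence pole0: "is_pole wp 0" by (simp add: wp_eq_punctured[abs_def] add.commute)
  have "eventually (\<lambda>w. wp w = wp (\<tau> + w)) (at 0)"
    using eventually_notin_L[of 0] 
    by eventually_elim (use assms in \<open>simp add: wp_periodic add.commute\<close>)
  from is_pole_cong[OF this refl] pole0 have "is_pole (\<lambda>w. wp (\<tau> + w)) 0" by simp
  thus ?thesis by (simp add: is_pole_shift_0[of wp \<tau>] add.commute)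
qed

lemma wp_meromorphic: "wp meromorphic_on UNIV"
proof (rule meromorphic_onI_open[of _ _ L])
  show "wp analytic_on UNIV - L"
    using wp_holomorphic analytic_on_open[OF open_compl_L] unfolding Compl_eq_Diff_UNIV by simp
  show "not_essential wp z" if "z \<in> L" for z
    using is_pole_wp[OF that] by (auto simp: not_essential_def)
  show "\<not> z islimpt L \<inter> UNIV" for z
    using sparse_L by (simp add: sparse_in_open)
qed auto

lemma wp'_meromorphic: "wp' meromorphic_on UNIV"
  by (intro meromorphic_on_deriv wp_meromorphic)

text \<open>The remainder has coordinates in \<open>[0, 1)\<close> with respect to the basis \<open>\<omega>\<^sub>1, \<omega>\<^sub>2\<close>.\<close>

lemma reduce_modulo_L:
  obtains \<tau> where "\<tau> \<in> L" "norm (z - \<tau>) \<le> norm \<omega>\<^sub>1 + norm \<omega>\<^sub>2"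
proof -
  define \<rho> where "\<rho> = \<omega>\<^sub>1 / \<omega>\<^sub>2"
  have w2: "\<omega>\<^sub>2 \<noteq> 0" using indep by auto
  define a where "a = Im (z / \<omega>\<^sub>2) / Im \<rho>"
  define b where "b = Re (z / \<omega>\<^sub>2) - a * Re \<rho>"
  have "Im \<rho> \<noteq> 0" using indep by (simp add: \<rho>_def)
  hence "a * Im \<rho> = Im (z / \<omega>\<^sub>2)" by (simp add: a_def)
  hence "z / \<omega>\<^sub>2 = of_real a * \<rho> + of_real b"
    by (intro complex_eqI) (simp_all add: b_def)
  hence z: "z = of_real a * \<omega>\<^sub>1 + of_real b * \<omega>\<^sub>2"
    using w2 by (simp add: \<rho>_def field_simps)
  define \<tau> where "\<tau> = lat (\<lfloor>a\<rfloor>, \<lfloor>b\<rfloor>)"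
  have "z - \<tau> = of_real (frac a) * \<omega>\<^sub>1 + of_real (frac b) * \<omega>\<^sub>2"
    by (simp add: z \<tau>_def lat_def frac_def algebra_simps)
  hence "norm (z - \<tau>) \<le> frac a * norm \<omega>\<^sub>1 + frac b * norm \<omega>\<^sub>2"
    by (metis (no_types, lifting) abs_of_nonneg frac_ge_0 norm_mult norm_of_real norm_triangle_ineq)
  also have "\<dots> \<le> 1 * norm \<omega>\<^sub>1 + 1 * norm \<omega>\<^sub>2"
    by (intro add_mono mult_right_mono) (use frac_lt_1[of a] frac_lt_1[of b] in auto)
  finally show ?thesis by (intro that[of \<tau>]) (auto simp: \<tau>_def L_eq)
qed

text \<open>If \<open>\<wp>\<close> omitted \<open>a\<close>, then \<open>1 / (\<wp> - a)\<close> would extend to an entire periodic function, which is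
  bounded and therefore constant. But it vanishes exactly at the lattice points.\<close>

lemma wp_surj: obtains w where "w \<notin> L" "wp w = a"
proof -
  have "\<exists>w. w \<notin> L \<and> wp w = a"
  proof (rule ccontr)
    assume *: "\<not> (\<exists>w. w \<notin> L \<and> wp w = a)"
    define q where "q = (\<lambda>z. inverse (wp z - a))"
    have mero: "q meromorphic_on UNIV"
      unfolding q_def by (intro meromorphic_intros wp_meromorphic)
    have q_pole: "q \<midarrow>z\<rightarrow> 0" if "z \<in> L" for z
    proof -
      have "filterlim (\<lambda>z. - a + wp z) at_infinity (at z)"
        using is_pole_wp[OF that] unfolding is_pole_def
        by (intro tendsto_add_filterlim_at_infinity[OF tendsto_const])
      from filterlim_compose[OF tendsto_inverse_0 this] show ?thesis by (simp add: q_def)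
    qed
    have q_cont: "q \<midarrow>z\<rightarrow> q z" if "z \<notin> L" for z
    proof -
      have "isCont wp z" using wp_derivative_sum(1)[OF that] by (rule DERIV_isCont)
      hence "isCont q z" using * that unfolding q_def by (intro continuous_intros) auto
      thus ?thesis by (simp add: isCont_def)
    qed
    define K where "K = remove_sings q"
    have K: "K holomorphic_on UNIV"
      unfolding K_def by (rule meromorphic_entire_extension[OF mero]) (use q_pole q_cont in blast)
    have K0: "K z = 0" if "z \<in> L" for z using q_pole[OF that] by (auto simp: K_def)
    have Kq: "K z = q z" if "z \<notin> L" for z using q_cont[OF that] by (auto simp: K_def)
    have per: "K (z - \<tau>) = K z" if "\<tau> \<in> L" for z \<tau>
    proof (cases "z \<in> L")
      case True thus ?thesis using that by (simp add: K0 L_diff)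
    next
      case False
      hence "z - \<tau> \<notin> L" using L_add_iff[OF that, of "z - \<tau>"] by simp
      thus ?thesis using False wp_periodic[of z "- \<tau>"] that by (simp add: Kq q_def)
    qed
    have "continuous_on (cball 0 (norm \<omega>\<^sub>1 + norm \<omega>\<^sub>2)) K"
      using K holomorphic_on_imp_continuous_on continuous_on_subset by blast
    hence "bounded (K ` cball 0 (norm \<omega>\<^sub>1 + norm \<omega>\<^sub>2))"
      by (intro compact_imp_bounded compact_continuous_image) auto
    moreover have "range K \<subseteq> K ` cball 0 (norm \<omega>\<^sub>1 + norm \<omega>\<^sub>2)"
    proof
      fix y assume "y \<in> range K"
      then obtain z where "y = K z" by auto
      moreover obtain \<tau> where "\<tau> \<in> L" "norm (z - \<tau>) \<le> norm \<omega>\<^sub>1 + norm \<omega>\<^sub>2"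
        using reduce_modulo_L by blast
      ultimately show "y \<in> K ` cball 0 (norm \<omega>\<^sub>1 + norm \<omega>\<^sub>2)"
        using per[of \<tau> z] by (intro image_eqI[of _ _ "z - \<tau>"]) auto
    qed
    ultimately have "bounded (range K)" using bounded_subset by blast
    then obtain c where c: "\<And>z. K z = c"
      using Liouville_theorem[OF K] by (metis constant_on_def UNIV_I)
    obtain z :: complex where "z \<notin> L"
      using eventually_happens[OF eventually_notin_L[of 0]] by auto
    hence "K z \<noteq> 0" using * by (auto simp: Kq q_def)
    thus False using c K0[of 0] by simp
  qed
  thus ?thesis using that by blast
qed

text \<open>The poles of \<open>\<wp>\<close> are the lattice points, and a period moves the pole at the origin to itself.\<close>

lemma period_of_wp:
  assumes "\<forall>\<^sub>\<approx>w\<in>UNIV. wp (w + p) = wp w"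
  shows "p \<in> L"
proof (rule ccontr)
  assume "p \<notin> L"
  have "is_pole (\<lambda>w. wp (p + w)) 0 \<longleftrightarrow> is_pole wp 0"
    by (rule is_pole_cong) (use assms in \<open>auto simp: cosparse_UNIV_iff add.commute\<close>)
  hence "is_pole wp p" using is_pole_wp[of 0] is_pole_shift_0[of wp p] by simp
  moreover have "wp analytic_on {p}"
    using wp_holomorphic open_compl_L \<open>p \<notin> L\<close> by (auto simp: analytic_at)
  ultimately show False using analytic_at_imp_no_pole by blast
qed

end

section \<open>The Fermat cubic\<close>

abbreviation (input) sqrt3 :: complex where "sqrt3 \<equiv> complex_of_real (sqrt 3)"

lemma sqrt3_square: "sqrt3 * sqrt3 = 3" "sqrt3 ^ 2 = 3"
proof -
  have "sqrt3 ^ 2 = complex_of_real ((sqrt 3) ^ 2)" by (simp only: of_real_power)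
  thus "sqrt3 ^ 2 = 3" by simp
  thus "sqrt3 * sqrt3 = 3" by (simp add: power2_eq_square)
qed

text \<open>On \<open>X + Y = 0\<close> the cubic has only points at infinity.\<close>

lemma fermat_sum_nonzero:
  fixes a b :: complex
  assumes "a ^ 3 + b ^ 3 = 1"
  shows "a + b \<noteq> 0"
proof
  assume "a + b = 0"
  hence "a = - b" by (simp add: eq_neg_iff_add_eq_0)
  thus False using assms by simp
qed

text \<open>This is the factorisation \<open>4 (X^3 + Y^3) = (X + Y) ((X + Y)^2 + 3 (X - Y)^2)\<close>.\<close>

lemma fermat_to_weierstrass:
  fixes a b :: complex
  assumes "a ^ 3 + b ^ 3 = 1"
  shows "(sqrt3 * (a - b) / (a + b)) ^ 2 = 4 * (1 / (a + b)) ^ 3 - 1"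
proof -
  have nz: "a + b \<noteq> 0" using fermat_sum_nonzero[OF assms] .
  have *: "3 * (a - b) ^ 2 * (a + b) = 4 * 1 - (a + b) ^ 3"
    unfolding assms[symmetric] by (simp add: power2_eq_square power3_eq_cube algebra_simps)
  have "(sqrt3 * (a - b) / (a + b)) ^ 2 = 3 * (a - b) ^ 2 / (a + b) ^ 2"
    by (simp add: power_mult_distrib power_divide sqrt3_square)
  also have "\<dots> = 3 * (a - b) ^ 2 * (a + b) / ((a + b) ^ 2 * (a + b))"
    using nz by simp
  also have "(a + b) ^ 2 * (a + b) = (a + b) ^ 3"
    by (simp only: power2_eq_square power3_eq_cube)
  also have "3 * (a - b) ^ 2 * (a + b) / (a + b) ^ 3 = 4 * (1 / (a + b)) ^ 3 - 1"
    unfolding * using nz by (simp add: diff_divide_distrib power_divide)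
  finally show ?thesis .
qed

lemma weierstrass_to_fermat:
  fixes x y :: complex
  assumes "x \<noteq> 0" "y ^ 2 = 4 * x ^ 3 - 1"
  shows "((1/2 * (1 + y / sqrt3)) / x) ^ 3 + ((1/2 * (1 - y / sqrt3)) / x) ^ 3 = 1"
proof -
  define t where "t = y / sqrt3"
  have t: "3 * t ^ 2 = 4 * x ^ 3 - 1"
    using assms(2) by (simp add: t_def power_divide sqrt3_square)
  have "(1/2 * (1 + t)) ^ 3 + (1/2 * (1 - t)) ^ 3 = (2 + 2 * (3 * t ^ 2)) / 8"
    by (simp add: power2_eq_square power3_eq_cube field_simps)
  also have "\<dots> = x ^ 3" unfolding t by simp
  finally show ?thesis using assms(1)
    unfolding t_def[symmetric] power_divide add_divide_distrib[symmetric] by simp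
qed

lemma fermat_of_weierstrass_coords:
  fixes a b :: complex
  assumes "a + b \<noteq> 0"
  shows "(1/2 * (1 + (sqrt3 * (a - b) / (a + b)) / sqrt3)) / (1 / (a + b)) = a"
    and "(1/2 * (1 - (sqrt3 * (a - b) / (a + b)) / sqrt3)) / (1 / (a + b)) = b"
proof -
  have "(sqrt3 * (a - b) / (a + b)) / sqrt3 = (a - b) / (a + b)" by simp
  thus "(1/2 * (1 + (sqrt3 * (a - b) / (a + b)) / sqrt3)) / (1 / (a + b)) = a"
    and "(1/2 * (1 - (sqrt3 * (a - b) / (a + b)) / sqrt3)) / (1 / (a + b)) = b"
    using assms by (simp_all add: field_simps)
qed

lemma fermat_deriv_relation:
  assumes "f analytic_on {z}" "g analytic_on {z}" "eventually (\<lambda>w. f w ^ 3 + g w ^ 3 = c) (nhds z)"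
  shows "f z ^ 2 * deriv f z + g z ^ 2 * deriv g z = 0"
proof -
  have d: "(f has_field_derivative deriv f z) (at z)" "(g has_field_derivative deriv g z) (at z)"
    using assms(1,2) analytic_on_imp_differentiable_at DERIV_deriv_iff_field_differentiable by blast+
  have "((\<lambda>w. f w ^ 3 + g w ^ 3) has_field_derivative
      3 * (f z ^ 2 * deriv f z + g z ^ 2 * deriv g z)) (at z)"
    by (rule derivative_eq_intros d refl)+ (simp add: algebra_simps)
  moreover have "((\<lambda>w. f w ^ 3 + g w ^ 3) has_field_derivative 0) (at z)"
    by (subst DERIV_cong_ev[OF refl assms(3) refl]) simp
  ultimately have "3 * (f z ^ 2 * deriv f z + g z ^ 2 * deriv g z) = 0"
    using DERIV_unique by blast
  thus ?thesis by (metis mult_eq_0_iff zero_neq_numeral)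
qed

text \<open>The differential \<open>dX / (\<surd>3 Y^2)\<close> has no poles on the projective cubic, so its pullback has a
  finite limit everywhere. Where \<open>f\<close> is finite, so is \<open>g\<close>, and the form equals \<open>dX / (\<surd>3 Y^2)\<close> or
  \<open>- dY / (\<surd>3 X^2)\<close>; \<open>X\<close> and \<open>Y\<close> do not vanish simultaneously. At a pole of \<open>f\<close> the coordinates
  \<open>u = 1 / X\<close> and \<open>v = Y / X\<close> are finite, \<open>v^3 = u^3 - 1\<close> is close to \<open>-1\<close>, and the form is
  \<open>- du / (\<surd>3 v^2)\<close>.\<close>

lemma fermat_differential_limit:
  assumes f: "f meromorphic_on UNIV" and g: "g meromorphic_on UNIV"
    and eq: "\<forall>\<^sub>\<approx>z\<in>UNIV. f z ^ 3 + g z ^ 3 = 1" and gnz: "\<forall>\<^sub>\<approx>z\<in>UNIV. g z \<noteq> 0"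
  shows "\<exists>l. (\<lambda>z. deriv f z / (sqrt3 * g z ^ 2)) \<midarrow>z\<rightarrow> l"
proof (cases "\<exists>a. f \<midarrow>z\<rightarrow> a")
  case True
  then obtain a where a: "f \<midarrow>z\<rightarrow> a" by blast
  define f0 where "f0 = remove_sings f"
  define g0 where "g0 = remove_sings g"
  have isof: "isolated_singularity_at f z" and isog: "isolated_singularity_at g z"
    using f g meromorphic_on_isolated_singularity meromorphic_on_subset by blast+
  have f0: "f0 analytic_on {z}" unfolding f0_def by (rule remove_sings_analytic_at[OF isof a])
  have evf: "eventually (\<lambda>w. f0 w = f w) (at z)" and evg: "eventually (\<lambda>w. g0 w = g w) (at z)"
    unfolding f0_def g0_def using isof isog eventually_remove_sings_eq_at by blast+
  have eqz: "eventually (\<lambda>w. f w ^ 3 + g w ^ 3 = 1) (at z)" "eventually (\<lambda>w. g w \<noteq> 0) (at z)"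
    using eq gnz by (simp_all add: cosparse_UNIV_iff)
  have ev3: "eventually (\<lambda>w. g w ^ 3 = 1 - f w ^ 3) (at z)"
    using eqz(1) by eventually_elim (simp add: algebra_simps)
  have lim3: "((\<lambda>w. 1 - f w ^ 3) \<longlongrightarrow> 1 - a ^ 3) (at z)" using a by (intro tendsto_intros)
  note g0 = remove_sings_analytic_of_cube_limit[OF g ev3 lim3, folded g0_def]
  have f0z: "f0 z = a" unfolding f0_def using a by auto
  have "eventually (\<lambda>w. f0 w ^ 3 + g0 w ^ 3 = 1) (at z)"
    using evf evg eqz(1) by eventually_elim simp
  moreover have "f0 z ^ 3 + g0 z ^ 3 = 1" using g0(2) f0z by simp
  ultimately have eq0: "eventually (\<lambda>w. f0 w ^ 3 + g0 w ^ 3 = 1) (nhds z)"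
    by (simp add: eventually_nhds_conv_at)
  have evan: "eventually (\<lambda>w. f0 analytic_on {w}) (at z)" "eventually (\<lambda>w. g0 analytic_on {w}) (at z)"
    using f0 g0(1) by (simp_all add: eventually_analytic_at)
  have evd: "eventually (\<lambda>w. deriv f0 w = deriv f w) (at z)"
    by (rule eventually_at_deriv_cong[OF evf])
  have df0: "deriv f0 \<midarrow>z\<rightarrow> deriv f0 z" and dg0: "deriv g0 \<midarrow>z\<rightarrow> deriv g0 z"
    using f0 g0(1) by (simp_all add: analytic_deriv tendsto_analytic)
  show ?thesis
  proof (cases "g0 z = 0")
    case False
    have "(\<lambda>w. deriv f0 w / (sqrt3 * g0 w ^ 2)) \<midarrow>z\<rightarrow> deriv f0 z / (sqrt3 * g0 z ^ 2)"
      using False by (intro tendsto_intros df0 tendsto_analytic[OF g0(1)]) simp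
    moreover have "eventually (\<lambda>w. deriv f0 w / (sqrt3 * g0 w ^ 2) = deriv f w / (sqrt3 * g w ^ 2)) (at z)"
      using evd evg by eventually_elim simp
    ultimately show ?thesis by (intro exI) (rule Lim_transform_eventually)
  next
    case True
    hence fz: "f0 z \<noteq> 0" using g0(2) f0z by auto
    have lim: "(\<lambda>w. - deriv g0 w / (sqrt3 * f0 w ^ 2)) \<midarrow>z\<rightarrow> - deriv g0 z / (sqrt3 * f0 z ^ 2)"
      using fz by (intro tendsto_intros dg0 tendsto_analytic[OF f0]) simp
    have "eventually (\<lambda>w. f0 w \<noteq> 0) (at z)"
      using tendsto_analytic[OF f0] fz by (rule tendsto_imp_eventually_ne)
    moreover have "eventually (\<lambda>w. eventually (\<lambda>w. f0 w ^ 3 + g0 w ^ 3 = 1) (nhds w)) (at z)"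
      using eq0 by (intro eventually_at_eventually_nhds) (simp add: eventually_nhds_conv_at)
    ultimately have "eventually (\<lambda>w. - deriv g0 w / (sqrt3 * f0 w ^ 2) = deriv f w / (sqrt3 * g w ^ 2)) (at z)"
      using evan evd evg eqz(2)
    proof eventually_elim
      case (elim w)
      have "f0 w ^ 2 * deriv f0 w + g0 w ^ 2 * deriv g0 w = 0"
        by (rule fermat_deriv_relation) (use elim in auto)
      hence *: "- (deriv g0 w * g0 w ^ 2) = deriv f0 w * f0 w ^ 2"
        by (simp add: algebra_simps neg_eq_iff_add_eq_0)
      have nz: "f0 w ^ 2 \<noteq> 0" "g0 w ^ 2 \<noteq> 0" using elim by auto
      have "- deriv g0 w / f0 w ^ 2 = deriv f0 w / g0 w ^ 2"
        unfolding frac_eq_eq[OF nz] using * by simp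
      hence "- deriv g0 w / f0 w ^ 2 / sqrt3 = deriv f0 w / g0 w ^ 2 / sqrt3" by (rule arg_cong)
      hence "- deriv g0 w / (sqrt3 * f0 w ^ 2) = deriv f0 w / (sqrt3 * g0 w ^ 2)"
        unfolding divide_divide_eq_left by (simp only: mult.commute)
      thus ?case using elim by simp
    qed
    with lim show ?thesis by (intro exI) (rule Lim_transform_eventually)
  qed
next
  case False
  have iso: "isolated_singularity_at f z" "not_essential f z"
    using f meromorphic_on_isolated_singularity meromorphic_on_not_essential meromorphic_on_subset by blast+
  have pole: "is_pole f z" using iso(2) False by (auto simp: not_essential_def)
  \<comment> \<open>Projective coordinates \<open>u = 1 / X\<close> and \<open>v = Y / X\<close> near the points at infinity.\<close>
  define u where "u = remove_sings (\<lambda>w. inverse (f w))"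
  define v where "v = remove_sings (\<lambda>w. g w / f w)"
  have um: "(\<lambda>w. inverse (f w)) meromorphic_on UNIV" and vm: "(\<lambda>w. g w / f w) meromorphic_on UNIV"
    by (intro meromorphic_intros f g)+
  have isou: "isolated_singularity_at (\<lambda>w. inverse (f w)) z" and isov: "isolated_singularity_at (\<lambda>w. g w / f w) z"
    using um vm meromorphic_on_isolated_singularity meromorphic_on_subset by blast+
  have lim0: "(\<lambda>w. inverse (f w)) \<midarrow>z\<rightarrow> 0"
    using pole unfolding is_pole_def by (rule filterlim_compose[OF tendsto_inverse_0])
  have fnz: "eventually (\<lambda>w. f w \<noteq> 0) (at z)" using pole by (rule non_zero_neighbour_pole)
  have eqz: "eventually (\<lambda>w. f w ^ 3 + g w ^ 3 = 1) (at z)" "eventually (\<lambda>w. g w \<noteq> 0) (at z)"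
    using eq gnz by (simp_all add: cosparse_UNIV_iff)
  have u: "u analytic_on {z}" unfolding u_def by (rule remove_sings_analytic_at[OF isou lim0])
  have evu: "eventually (\<lambda>w. u w = inverse (f w)) (at z)" and evv: "eventually (\<lambda>w. v w = g w / f w) (at z)"
    unfolding u_def v_def using isou isov eventually_remove_sings_eq_at by blast+
  have ev3: "eventually (\<lambda>w. (g w / f w) ^ 3 = inverse (f w) ^ 3 - 1) (at z)"
    using eqz(1) fnz
  proof eventually_elim
    case (elim w)
    have "g w ^ 3 = 1 - f w ^ 3" using elim(1) by (simp add: algebra_simps)
    hence "(g w / f w) ^ 3 = (1 - f w ^ 3) / f w ^ 3" by (simp add: power_divide)
    also have "\<dots> = inverse (f w) ^ 3 - 1"
      using elim(2) by (simp add: diff_divide_distrib inverse_eq_divide power_one_over)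
    finally show ?case .
  qed
  have lim3: "((\<lambda>w. inverse (f w) ^ 3 - 1) \<longlongrightarrow> 0 ^ 3 - 1) (at z)" using lim0 by (intro tendsto_intros)
  note v = remove_sings_analytic_of_cube_limit[OF vm ev3 lim3, folded v_def]
  have vz: "v z \<noteq> 0" using v(2) by auto
  have lim: "(\<lambda>w. - deriv u w / (sqrt3 * v w ^ 2)) \<midarrow>z\<rightarrow> - deriv u z / (sqrt3 * v z ^ 2)"
    using vz by (intro tendsto_intros tendsto_analytic v u analytic_deriv) simp
  have "eventually (\<lambda>w. f w = inverse (u w)) (at z)" using evu by eventually_elim simp
  hence "eventually (\<lambda>w. deriv f w = deriv (\<lambda>w. inverse (u w)) w) (at z)"
    by (rule eventually_at_deriv_cong)
  moreover have "eventually (\<lambda>w. u analytic_on {w}) (at z)"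
    using u by (simp add: eventually_analytic_at)
  ultimately have "eventually (\<lambda>w. - deriv u w / (sqrt3 * v w ^ 2) = deriv f w / (sqrt3 * g w ^ 2)) (at z)"
    using evu evv fnz eqz(2)
  proof eventually_elim
    case (elim w)
    have unz: "u w \<noteq> 0" using elim by simp
    have "(u has_field_derivative deriv u w) (at w)"
      using elim analytic_on_imp_differentiable_at DERIV_deriv_iff_field_differentiable by blast
    from DERIV_inverse'[OF this unz] have "deriv f w = - (inverse (u w) * deriv u w * inverse (u w))"
      unfolding elim(1) by (rule DERIV_imp_deriv)
    hence 1: "deriv f w = - deriv u w * f w ^ 2" using elim by (simp add: power2_eq_square)
    have 2: "v w ^ 2 = g w ^ 2 / f w ^ 2" using elim by (simp add: power_divide)
    show ?case unfolding 1 2 by simp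
  qed
  with lim show ?thesis by (intro exI) (rule Lim_transform_eventually)
qed

section \<open>Lifting maps into the Fermat cubic to the plane\<close>

text \<open>The differential equation normalises the invariants of the lattice to \<open>g\<^sub>2 = 0\<close> and \<open>g\<^sub>3 = 1\<close>.\<close>

locale equianharmonic_lattice = complex_lattice +
  assumes ode: "\<And>z. z \<notin> L \<Longrightarrow> wp' z ^ 2 = 4 * wp z ^ 3 - 1"
begin

definition fermat_x :: "complex \<Rightarrow> complex" where
  "fermat_x w = (1/2 * (1 + wp' w / sqrt3)) / wp w"

definition fermat_y :: "complex \<Rightarrow> complex" where
  "fermat_y w = (1/2 * (1 - wp' w / sqrt3)) / wp w"

lemma fermat_x_meromorphic: "fermat_x meromorphic_on UNIV"
  unfolding fermat_x_def[abs_def] by (intro meromorphic_intros wp_meromorphic wp'_meromorphic)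

lemma fermat_y_meromorphic: "fermat_y meromorphic_on UNIV"
  unfolding fermat_y_def[abs_def] by (intro meromorphic_intros wp_meromorphic wp'_meromorphic)

lemma fermat_minus:
  assumes "w \<notin> L"
  shows "fermat_x (- w) = fermat_y w" "fermat_y (- w) = fermat_x w"
  using assms by (simp_all add: fermat_x_def fermat_y_def wp_even wp'_odd)

lemma fermat_cubes:
  assumes "w \<notin> L" "wp w \<noteq> 0"
  shows "fermat_x w ^ 3 + fermat_y w ^ 3 = 1"
  unfolding fermat_x_def fermat_y_def by (rule weierstrass_to_fermat) (use assms ode in auto)

lemma fermat_sum: "fermat_x w + fermat_y w = 1 / wp w"
proof -
  have "1/2 * (1 + t) + 1/2 * (1 - t) = 1" for t :: complex by (simp add: field_simps)
  thus ?thesis unfolding fermat_x_def fermat_y_def add_divide_distrib[symmetric] by simp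
qed

lemma fermat_diff: "fermat_x w - fermat_y w = wp' w / (sqrt3 * wp w)"
proof -
  have "1/2 * (1 + t) - 1/2 * (1 - t) = t" for t :: complex by (simp add: field_simps)
  thus ?thesis unfolding fermat_x_def fermat_y_def diff_divide_distrib[symmetric] by simp
qed

lemma wp_of_fermat:
  assumes "wp w \<noteq> 0"
  shows "wp w = 1 / (fermat_x w + fermat_y w)"
    and "wp' w = sqrt3 * (fermat_x w - fermat_y w) / (fermat_x w + fermat_y w)"
  using assms by (simp_all add: fermat_sum fermat_diff)

lemma fermat_of_wp_eq:
  assumes "a + b \<noteq> 0" "wp w = 1 / (a + b)" "wp' w = sqrt3 * (a - b) / (a + b)"
  shows "fermat_x w = a" "fermat_y w = b"
  unfolding fermat_x_def fermat_y_def assms(2,3)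
  using fermat_of_weierstrass_coords[OF assms(1)] by simp_all

lemma cosparse_notin_L: "\<forall>\<^sub>\<approx>w\<in>UNIV. w \<notin> L"
  using eventually_notin_L by (simp add: cosparse_UNIV_iff)

lemma wp_at_infinity: "filterlim wp at_infinity (at 0)"
  using is_pole_wp[of 0] by (simp add: is_pole_def)

lemma cosparse_wp_neq: "\<forall>\<^sub>\<approx>w\<in>UNIV. wp w \<noteq> a"
proof -
  have "\<not> (\<forall>\<^sub>\<approx>w\<in>UNIV. wp w = a)"
  proof
    assume "\<forall>\<^sub>\<approx>w\<in>UNIV. wp w = a"
    hence "eventually (\<lambda>w. wp w = a) (at 0)" by (simp add: cosparse_UNIV_iff)
    moreover have "eventually (\<lambda>w. wp w \<noteq> a) (at 0)"
      using wp_at_infinity by (rule filterlim_at_infinity_imp_eventually_ne)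
    ultimately have "eventually (\<lambda>_::complex. False) (at 0)" by eventually_elim simp
    thus False by simp
  qed
  thus ?thesis
    using meromorphic_imp_constant_or_avoid[OF wp_meromorphic open_UNIV connected_UNIV, of a] by blast
qed

text \<open>If \<open>\<wp>'\<close> vanished, then \<open>\<wp>^3\<close> would be \<open>1/4\<close> and \<open>\<wp>\<close> constant.\<close>

lemma cosparse_wp'_nonzero: "\<forall>\<^sub>\<approx>w\<in>UNIV. wp' w \<noteq> 0"
proof -
  have "\<not> (\<forall>\<^sub>\<approx>w\<in>UNIV. wp' w = 0)"
  proof
    assume "\<forall>\<^sub>\<approx>w\<in>UNIV. wp' w = 0"
    hence "\<forall>\<^sub>\<approx>w\<in>UNIV. wp w ^ 3 = 1 / 4"
      using cosparse_notin_L
    proof eventually_elim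
      case (elim w)
      thus ?case using ode[of w] by (simp add: mult.commute)
    qed
    then obtain c where "\<forall>\<^sub>\<approx>w\<in>UNIV. wp w = c"
      using meromorphic_cube_constant[OF wp_meromorphic] by blast
    with cosparse_wp_neq[of c] have "eventually (\<lambda>_. False) (cosparse (UNIV :: complex set))"
      by eventually_elim simp
    thus False by simp
  qed
  thus ?thesis
    using meromorphic_imp_constant_or_avoid[OF wp'_meromorphic open_UNIV connected_UNIV, of 0] by blast
qed

lemma cosparse_fermat_cubes: "\<forall>\<^sub>\<approx>w\<in>UNIV. fermat_x w ^ 3 + fermat_y w ^ 3 = 1"
  using cosparse_notin_L cosparse_wp_neq[of 0] by eventually_elim (rule fermat_cubes)

text \<open>Otherwise \<open>fermat_y w = fermat_x (- w)\<close> would be constant too, and with it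
  \<open>\<wp> = 1 / (fermat_x + fermat_y)\<close>.\<close>

lemma fermat_x_nonconstant: "nonconstant_meromorphic fermat_x"
  unfolding nonconstant_meromorphic_def
proof (intro conjI notI fermat_x_meromorphic)
  assume "\<exists>a. \<forall>\<^sub>\<approx>w\<in>UNIV. fermat_x w = a"
  then obtain a where a: "\<forall>\<^sub>\<approx>w\<in>UNIV. fermat_x w = a" by blast
  have "nonconstant_entire (\<lambda>w. - w)" using nonconstant_entire_affine[of "-1" 0] by simp
  from cosparse_compose_entire[OF this a] have "\<forall>\<^sub>\<approx>w\<in>UNIV. fermat_x (- w) = a" .
  hence "\<forall>\<^sub>\<approx>w\<in>UNIV. wp w = 1 / (a + a)"
    using a cosparse_notin_L cosparse_wp_neq[of 0]
  proof eventually_elim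
    case (elim w)
    thus ?case using wp_of_fermat(1)[of w] fermat_minus(1)[of w] by simp
  qed
  with cosparse_wp_neq[of "1 / (a + a)"] have "eventually (\<lambda>_. False) (cosparse (UNIV :: complex set))"
    by eventually_elim simp
  thus False by simp
qed

text \<open>As \<open>\<wp>\<close> is even and \<open>\<wp>'\<close> is odd, replacing \<open>w\<close> by \<open>- w\<close> corrects the sign of \<open>\<wp>'\<close>.\<close>

lemma wp_surj_curve:
  assumes "y ^ 2 = 4 * x ^ 3 - 1"
  obtains w where "w \<notin> L" "wp w = x" "wp' w = y"
proof -
  obtain w where w: "w \<notin> L" "wp w = x" using wp_surj by blast
  have "wp' w ^ 2 = y ^ 2" using ode[OF w(1)] w(2) assms by simp
  hence "wp' w = y \<or> wp' w = - y" by (simp add: power2_eq_iff)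
  thus ?thesis
  proof
    assume "wp' w = - y"
    thus ?thesis using w wp'_odd[OF w(1)] by (intro that[of "- w"]) (auto simp: wp_even)
  qed (use w that in blast)
qed

text \<open>Uniqueness for the differential equation \<open>h' = x' / y\<close>: a local inverse of \<open>\<wp>\<close> applied to \<open>x\<close> solves
  it with the same initial value, hence coincides with \<open>h\<close>.\<close>

lemma wp_local_lift:
  assumes r: "r > 0"
    and x: "x holomorphic_on ball z\<^sub>0 r" and y: "y holomorphic_on ball z\<^sub>0 r"
    and curve: "\<And>z. z \<in> ball z\<^sub>0 r \<Longrightarrow> y z ^ 2 = 4 * x z ^ 3 - 1"
    and ynz: "\<And>z. z \<in> ball z\<^sub>0 r \<Longrightarrow> y z \<noteq> 0"
    and h: "\<And>z. z \<in> ball z\<^sub>0 r \<Longrightarrow> (h has_field_derivative deriv x z / y z) (at z)"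
    and init: "h z\<^sub>0 \<notin> L" "wp (h z\<^sub>0) = x z\<^sub>0" "wp' (h z\<^sub>0) = y z\<^sub>0"
  obtains s where "s > 0" "\<And>z. z \<in> ball z\<^sub>0 s \<Longrightarrow> wp (h z) = x z \<and> wp' (h z) = y z"
proof -
  have z0: "z\<^sub>0 \<in> ball z\<^sub>0 r" using r by simp
  have "wp' (h z\<^sub>0) \<noteq> 0" using ynz[OF z0] init by simp
  from has_complex_derivative_locally_invertible[OF wp_holomorphic _ open_compl_L this]
  obtain \<rho> where \<rho>: "\<rho> > 0" "ball (h z\<^sub>0) \<rho> \<subseteq> - L" "open (wp ` ball (h z\<^sub>0) \<rho>)" "inj_on wp (ball (h z\<^sub>0) \<rho>)"
    using init(1) by auto
  define U where "U = ball (h z\<^sub>0) \<rho>"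
  have UL: "w \<notin> L" if "w \<in> U" for w using that \<rho>(2) by (auto simp: U_def)
  have "wp holomorphic_on U" using wp_holomorphic \<rho>(2) holomorphic_on_subset by (auto simp: U_def)
  from holomorphic_has_inverse[OF this] \<rho>(4)
  obtain g where g: "g holomorphic_on wp ` U" "\<And>w. w \<in> U \<Longrightarrow> wp' w * deriv g (wp w) = 1"
    "\<And>w. w \<in> U \<Longrightarrow> g (wp w) = w"
    by (auto simp: U_def)
  have oU: "open (wp ` U)" using \<rho>(3) by (simp add: U_def)
  have "continuous_on (ball z\<^sub>0 r) x" using x by (rule holomorphic_on_imp_continuous_on)
  hence "open (ball z\<^sub>0 r \<inter> x -` (wp ` U))" using oU by (intro continuous_open_preimage) auto
  moreover have "z\<^sub>0 \<in> ball z\<^sub>0 r \<inter> x -` (wp ` U)"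
    using z0 init(2) \<rho>(1) by (auto simp: U_def image_iff intro!: bexI[of _ "h z\<^sub>0"])
  ultimately obtain s where s: "s > 0" "ball z\<^sub>0 s \<subseteq> ball z\<^sub>0 r \<inter> x -` (wp ` U)"
    by (metis open_contains_ball)
  define B where "B = ball z\<^sub>0 s"
  have Br: "z \<in> ball z\<^sub>0 r" and xU: "x z \<in> wp ` U" if "z \<in> B" for z using that s(2) by (auto simp: B_def)
  have z0B: "z\<^sub>0 \<in> B" using s by (simp add: B_def)
  define k where "k = (\<lambda>z. g (x z))"
  have kU: "k z \<in> U" and wpk: "wp (k z) = x z" if "z \<in> B" for z
    using xU[OF that] g(3) by (auto simp: k_def)
  have k0: "k z\<^sub>0 = h z\<^sub>0" using g(3)[of "h z\<^sub>0"] init(2) \<rho>(1) by (simp add: k_def U_def)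
  have xB: "x holomorphic_on B" and yB: "y holomorphic_on B"
    using x y Br by (auto intro: holomorphic_on_subset)
  have kh: "k holomorphic_on B"
    unfolding k_def using holomorphic_on_compose_gen[OF xB g(1)] xU by (auto simp: o_def)
  have "wp' holomorphic_on - L" using wp_holomorphic open_compl_L by (rule holomorphic_deriv)
  hence wpk': "(\<lambda>z. wp' (k z)) holomorphic_on B"
    using holomorphic_on_compose_gen[OF kh, of wp' "- L"] kU UL by (auto simp: o_def)
  \<comment> \<open>The curve equation determines \<open>wp' (k z)\<close> up to sign; the sign is constant by continuity.\<close>
  define q where "q = (\<lambda>z. wp' (k z) / y z)"
  have "q constant_on B"
  proof (rule continuous_finite_range_constant)
    show "connected B" by (simp add: B_def)
    show "continuous_on B q"
      unfolding q_def using wpk' yB ynz Br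
      by (intro holomorphic_on_imp_continuous_on holomorphic_intros) auto
    have "q z ^ 2 = 1" if "z \<in> B" for z
    proof -
      have "wp' (k z) ^ 2 = y z ^ 2"
        using ode[OF UL[OF kU[OF that]]] wpk[OF that] curve[OF Br[OF that]] by simp
      moreover have "y z ^ 2 \<noteq> 0" using ynz[OF Br[OF that]] by simp
      ultimately show ?thesis unfolding q_def power_divide by simp
    qed
    hence "q ` B \<subseteq> {1, -1}" by (auto simp: power2_eq_1_iff)
    thus "finite (q ` B)" by (rule finite_subset) simp
  qed
  moreover have "q z\<^sub>0 = 1" using k0 init(3) ynz[OF z0] by (simp add: q_def)
  ultimately have q1: "q z = 1" if "z \<in> B" for z using that z0B by (auto simp: constant_on_def)
  have wpk1: "wp' (k z) = y z" if "z \<in> B" for z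
    using q1[OF that] ynz[OF Br[OF that]] by (simp add: q_def)
  have kd: "(k has_field_derivative deriv x z / y z) (at z)" if z: "z \<in> B" for z
  proof -
    have "(x has_field_derivative deriv x z) (at z)"
      using xB z by (auto simp: B_def intro: holomorphic_derivI)
    moreover have "(g has_field_derivative deriv g (x z)) (at (x z))"
      using g(1) oU xU[OF z] by (rule holomorphic_derivI)
    ultimately have "(k has_field_derivative deriv g (x z) * deriv x z) (at z)"
      unfolding k_def by (rule DERIV_chain2[rotated])
    moreover have "y z * deriv g (x z) = 1"
      using g(2)[OF kU[OF z]] wpk[OF z] wpk1[OF z] by simp
    hence "deriv g (x z) = 1 / y z" using ynz[OF Br[OF z]] by (simp add: field_simps)
    ultimately show ?thesis by simp
  qed
  have "\<exists>c. \<forall>z\<in>B. k z - h z = c"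
  proof (rule has_field_derivative_zero_constant)
    show "convex B" by (simp add: B_def)
    show "((\<lambda>z. k z - h z) has_field_derivative 0) (at z within B)" if "z \<in> B" for z
      using DERIV_diff[OF kd[OF that] h[OF Br[OF that]]] by (simp add: has_field_derivative_at_within)
  qed
  then obtain c where c: "\<And>z. z \<in> B \<Longrightarrow> k z - h z = c" by blast
  have "c = 0" using c[OF z0B] k0 by simp
  hence "k z = h z" if "z \<in> B" for z using c[OF that] by simp
  thus ?thesis using wpk wpk1 s(1) by (intro that[of s]) (auto simp: B_def)
qed

text \<open>The formula for \<open>deriv h\<close> is part of the conclusion because it determines the lift when the
  pullback of the invariant differential can be computed.\<close>

theorem fermat_lift:
  assumes f: "nonconstant_meromorphic f" and g: "g meromorphic_on UNIV"
    and eq: "\<forall>\<^sub>\<approx>z\<in>UNIV. f z ^ 3 + g z ^ 3 = 1"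
  obtains h where "nonconstant_entire h"
    "\<forall>\<^sub>\<approx>z\<in>UNIV. fermat_x (h z) = f z" "\<forall>\<^sub>\<approx>z\<in>UNIV. fermat_y (h z) = g z"
    "\<forall>\<^sub>\<approx>z\<in>UNIV. deriv h z = deriv f z / (sqrt3 * g z ^ 2)"
proof -
  have fm: "f meromorphic_on UNIV" and fnc: "\<not> (\<exists>a. \<forall>\<^sub>\<approx>z\<in>UNIV. f z = a)"
    using f by (auto simp: nonconstant_meromorphic_def)
  have cube: "\<not> (\<forall>\<^sub>\<approx>z\<in>UNIV. f z ^ 3 = a)" for a
    using meromorphic_cube_constant[OF fm] fnc by blast
  have gnz: "\<forall>\<^sub>\<approx>z\<in>UNIV. g z \<noteq> 0"
  proof (rule ccontr)
    assume "\<not> (\<forall>\<^sub>\<approx>z\<in>UNIV. g z \<noteq> 0)"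
    hence "\<forall>\<^sub>\<approx>z\<in>UNIV. g z = 0"
      using meromorphic_imp_constant_or_avoid[OF g open_UNIV connected_UNIV, of 0] by blast
    with eq have "\<forall>\<^sub>\<approx>z\<in>UNIV. f z ^ 3 = 1" by eventually_elim simp
    thus False using cube by blast
  qed
  have fg: "\<forall>\<^sub>\<approx>z\<in>UNIV. f z - g z \<noteq> 0"
  proof (rule ccontr)
    have "(\<lambda>z. f z - g z) meromorphic_on UNIV" by (intro meromorphic_intros fm g)
    moreover assume "\<not> (\<forall>\<^sub>\<approx>z\<in>UNIV. f z - g z \<noteq> 0)"
    ultimately have "\<forall>\<^sub>\<approx>z\<in>UNIV. f z - g z = 0"
      using meromorphic_imp_constant_or_avoid[OF _ open_UNIV connected_UNIV, of _ 0] by blast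
    with eq have "\<forall>\<^sub>\<approx>z\<in>UNIV. f z ^ 3 = 1 / 2" by eventually_elim (simp add: mult.commute)
    thus False using cube by blast
  qed
  define k\<^sub>0 where "k\<^sub>0 = (\<lambda>z. deriv f z / (sqrt3 * g z ^ 2))"
  define k where "k = remove_sings k\<^sub>0"
  have k0m: "k\<^sub>0 meromorphic_on UNIV"
    unfolding k\<^sub>0_def by (intro meromorphic_intros fm g)
  have lim: "\<exists>l. k\<^sub>0 \<midarrow>z\<rightarrow> l" for z
    unfolding k\<^sub>0_def by (rule fermat_differential_limit[OF fm g eq gnz])
  have k: "k holomorphic_on UNIV" "\<forall>\<^sub>\<approx>z\<in>UNIV. k z = k\<^sub>0 z"
    unfolding k_def using meromorphic_entire_extension[OF k0m lim] by blast+
  have "\<forall>\<^sub>\<approx>z\<in>UNIV. f analytic_on {z} \<and> g analytic_on {z} \<and> f z ^ 3 + g z ^ 3 = 1 \<and>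
      g z \<noteq> 0 \<and> f z - g z \<noteq> 0 \<and> k z = k\<^sub>0 z"
    by (intro eventually_conj meromorphic_on_imp_analytic_cosparse fm g eq gnz fg k(2))
  then obtain z\<^sub>0 r where r: "r > 0" and ball: "\<And>z. z \<in> ball z\<^sub>0 r \<Longrightarrow> f analytic_on {z} \<and>
      g analytic_on {z} \<and> f z ^ 3 + g z ^ 3 = 1 \<and> g z \<noteq> 0 \<and> f z - g z \<noteq> 0 \<and> k z = k\<^sub>0 z"
    by (rule cosparse_UNIV_open_ball) (rule that)
  have fh: "f holomorphic_on ball z\<^sub>0 r" and gh: "g holomorphic_on ball z\<^sub>0 r"
    using ball by (meson analytic_imp_holomorphic analytic_on_analytic_at)+
  define x where "x = (\<lambda>z. 1 / (f z + g z))"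
  define y where "y = (\<lambda>z. sqrt3 * (f z - g z) / (f z + g z))"
  have nz: "f z + g z \<noteq> 0" if "z \<in> ball z\<^sub>0 r" for z
    using ball[OF that] fermat_sum_nonzero by blast
  have xh: "x holomorphic_on ball z\<^sub>0 r" and yh: "y holomorphic_on ball z\<^sub>0 r"
    unfolding x_def y_def using fh gh nz by (intro holomorphic_intros; simp)+
  have curve: "y z ^ 2 = 4 * x z ^ 3 - 1" if "z \<in> ball z\<^sub>0 r" for z
    using ball[OF that] fermat_to_weierstrass by (simp add: x_def y_def)
  have ynz: "y z \<noteq> 0" if "z \<in> ball z\<^sub>0 r" for z
    using ball[OF that] nz[OF that] by (simp add: y_def)
  have z0: "z\<^sub>0 \<in> ball z\<^sub>0 r" using r by simp
  obtain w\<^sub>0 where w0: "w\<^sub>0 \<notin> L" "wp w\<^sub>0 = x z\<^sub>0" "wp' w\<^sub>0 = y z\<^sub>0"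
    using wp_surj_curve[OF curve[OF z0]] by blast
  obtain H where H: "\<And>z. (H has_field_derivative k z) (at z)"
    using holomorphic_convex_primitive'[OF convex_UNIV open_UNIV k(1)] by auto
  define h where "h = (\<lambda>z. H z - H z\<^sub>0 + w\<^sub>0)"
  have hd: "(h has_field_derivative k z) (at z)" for z
    unfolding h_def using H[of z] by (auto intro!: derivative_eq_intros)
  \<comment> \<open>In the coordinates \<open>x, y\<close> the invariant differential is \<open>dx / y\<close>; eliminating \<open>deriv g\<close> by the
    differentiated equation gives the form in \<open>f\<close> and \<open>g\<close>.\<close>
  have kxy: "k z = deriv x z / y z" if z: "z \<in> ball z\<^sub>0 r" for z
  proof -
    note b = ball[OF z]
    have d: "(f has_field_derivative deriv f z) (at z)" "(g has_field_derivative deriv g z) (at z)"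
      using b analytic_derivI by blast+
    have "eventually (\<lambda>w. f w ^ 3 + g w ^ 3 = 1) (nhds z)"
      using eventually_nhds_in_open[OF open_ball z] by eventually_elim (use ball in blast)
    hence rel: "f z ^ 2 * deriv f z + g z ^ 2 * deriv g z = 0"
      using b by (intro fermat_deriv_relation) auto
    have "(x has_field_derivative - (deriv f z + deriv g z) / (f z + g z) ^ 2) (at z)"
      unfolding x_def using nz[OF z]
      by (auto intro!: derivative_eq_intros d simp: power2_eq_square)
    hence dx: "deriv x z = - (deriv f z + deriv g z) / (f z + g z) ^ 2" by (rule DERIV_imp_deriv)
    have "- (deriv f z + deriv g z) * g z ^ 2 = deriv f z * ((f z - g z) * (f z + g z))"
      using rel by (simp add: algebra_simps power2_eq_square neg_eq_iff_add_eq_0 add.commute)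
    moreover have "deriv x z / y z = - (deriv f z + deriv g z) / (sqrt3 * ((f z - g z) * (f z + g z)))"
      unfolding dx y_def using nz[OF z] b by (simp add: power2_eq_square)
    ultimately have "deriv x z / y z = deriv f z / (sqrt3 * g z ^ 2)"
      using nz[OF z] b by (simp add: frac_eq_eq mult.assoc mult.left_commute)
    thus ?thesis using b by (simp add: k\<^sub>0_def)
  qed
  obtain s where s: "s > 0" "\<And>z. z \<in> ball z\<^sub>0 s \<Longrightarrow> wp (h z) = x z \<and> wp' (h z) = y z"
  proof (rule wp_local_lift[OF r xh yh curve ynz, of h])
    show "(h has_field_derivative deriv x z / y z) (at z)" if "z \<in> ball z\<^sub>0 r" for z
      using hd[of z] kxy[OF that] by simp
  qed (use w0 in \<open>auto simp: h_def\<close>)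
  have near: "eventually (\<lambda>z. z \<in> ball z\<^sub>0 (min r s)) (at z\<^sub>0)"
    using r s(1) by (intro eventually_at_in_open') auto
  have pt: "fermat_x (h z) = f z \<and> fermat_y (h z) = g z" if "z \<in> ball z\<^sub>0 (min r s)" for z
    using fermat_of_wp_eq[OF nz, of z "h z"] s(2)[of z] that by (simp add: x_def y_def)
  have ev: "eventually (\<lambda>z. fermat_x (h z) = f z) (at z\<^sub>0)" "eventually (\<lambda>z. fermat_y (h z) = g z) (at z\<^sub>0)"
    using pt by (blast intro: eventually_mono[OF near])+
  have hh: "h holomorphic_on UNIV"
    using hd by (auto simp: holomorphic_on_open)
  have xy: "\<forall>\<^sub>\<approx>z\<in>UNIV. fermat_x (h z) = f z" "\<forall>\<^sub>\<approx>z\<in>UNIV. fermat_y (h z) = g z"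
    by (rule meromorphic_identity[OF meromorphic_compose_entire[OF fermat_x_meromorphic hh] fm ev(1)])
       (rule meromorphic_identity[OF meromorphic_compose_entire[OF fermat_y_meromorphic hh] g ev(2)])
  have "\<not> h constant_on UNIV"
  proof
    assume "h constant_on UNIV"
    then obtain c where "\<And>z. h z = c" by (auto simp: constant_on_def)
    with xy(1) have "\<forall>\<^sub>\<approx>z\<in>UNIV. f z = fermat_x c" by (simp add: eq_commute)
    thus False using fnc by blast
  qed
  hence "nonconstant_entire h" using hh by (simp add: nonconstant_entire_def)
  moreover have "\<forall>\<^sub>\<approx>z\<in>UNIV. deriv h z = deriv f z / (sqrt3 * g z ^ 2)"
    using k(2) by eventually_elim (simp add: k\<^sub>0_def DERIV_imp_deriv[OF hd])
  ultimately show ?thesis using xy that by blast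
qed

section \<open>Automorphisms of the Fermat cubic\<close>

lemma cosparse_fermat_y_nonzero: "\<forall>\<^sub>\<approx>w\<in>UNIV. fermat_y w \<noteq> 0"
proof (rule ccontr)
  assume "\<not> (\<forall>\<^sub>\<approx>w\<in>UNIV. fermat_y w \<noteq> 0)"
  hence "\<forall>\<^sub>\<approx>w\<in>UNIV. fermat_y w = 0"
    using meromorphic_imp_constant_or_avoid[OF fermat_y_meromorphic open_UNIV connected_UNIV, of 0] by blast
  with cosparse_fermat_cubes have "\<forall>\<^sub>\<approx>w\<in>UNIV. fermat_x w ^ 3 = 1" by eventually_elim simp
  from meromorphic_cube_constant[OF fermat_x_meromorphic this] fermat_x_nonconstant show False
    by (auto simp: nonconstant_meromorphic_def)
qed

text \<open>The invariant differential \<open>dX / (\<surd>3 Y^2)\<close> is \<open>dw\<close>. The two derivatives solve the linear system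
  that is obtained by differentiating \<open>X^3 + Y^3 = 1\<close> and \<open>X + Y = 1 / \<wp>\<close>.\<close>

lemma deriv_fermat_x: "\<forall>\<^sub>\<approx>w\<in>UNIV. deriv fermat_x w = sqrt3 * fermat_y w ^ 2"
proof -
  have "\<forall>\<^sub>\<approx>w\<in>UNIV. eventually (\<lambda>w. fermat_x w ^ 3 + fermat_y w ^ 3 = 1) (nhds w)"
    using cosparse_fermat_cubes eventually_at_eventually_nhds by (auto simp: cosparse_UNIV_iff)
  thus ?thesis
    using meromorphic_on_imp_analytic_cosparse[OF fermat_x_meromorphic]
      meromorphic_on_imp_analytic_cosparse[OF fermat_y_meromorphic]
      cosparse_notin_L cosparse_wp_neq[of 0] cosparse_wp'_nonzero
  proof eventually_elim
    case (elim w)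
    have rel: "fermat_x w ^ 2 * deriv fermat_x w + fermat_y w ^ 2 * deriv fermat_y w = 0"
      by (rule fermat_deriv_relation) (use elim in auto)
    have "((\<lambda>w. fermat_x w + fermat_y w) has_field_derivative deriv fermat_x w + deriv fermat_y w) (at w)"
      using elim by (intro DERIV_add analytic_derivI)
    moreover have "((\<lambda>w. inverse (wp w)) has_field_derivative - (inverse (wp w) * wp' w * inverse (wp w))) (at w)"
      using elim by (intro DERIV_inverse' wp_derivative_sum)
    hence "((\<lambda>w. fermat_x w + fermat_y w) has_field_derivative - (inverse (wp w) * wp' w * inverse (wp w))) (at w)"
      by (simp add: fermat_sum inverse_eq_divide)
    ultimately have sum: "deriv fermat_x w + deriv fermat_y w = - wp' w / wp w ^ 2"
      using DERIV_unique by (fastforce simp: power2_eq_square divide_inverse)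
    have "fermat_y w ^ 2 - fermat_x w ^ 2 = - ((fermat_x w - fermat_y w) * (fermat_x w + fermat_y w))"
      by (simp add: power2_eq_square algebra_simps)
    also have "\<dots> = - wp' w / wp w ^ 2 / sqrt3"
      by (simp add: fermat_sum fermat_diff power2_eq_square)
    finally have diff: "fermat_y w ^ 2 - fermat_x w ^ 2 = - wp' w / wp w ^ 2 / sqrt3" .
    have "deriv fermat_x w * (fermat_y w ^ 2 - fermat_x w ^ 2)
        = fermat_y w ^ 2 * (deriv fermat_x w + deriv fermat_y w)
          - (fermat_x w ^ 2 * deriv fermat_x w + fermat_y w ^ 2 * deriv fermat_y w)"
      by (simp add: algebra_simps)
    hence "deriv fermat_x w * (- wp' w / wp w ^ 2 / sqrt3) = fermat_y w ^ 2 * (- wp' w / wp w ^ 2)"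
      unfolding rel sum diff by simp
    moreover have "- wp' w / wp w ^ 2 \<noteq> 0" using elim by simp
    ultimately show ?case by (simp add: field_simps)
  qed
qed

text \<open>The lift of \<open>(\<alpha> X, \<beta> Y)\<close> has the derivative \<open>\<alpha> / \<beta>^2 = \<alpha> \<beta>\<close>.\<close>

lemma fermat_scaling:
  assumes "\<alpha> ^ 3 = 1" "\<beta> ^ 3 = 1"
  obtains b where "\<forall>\<^sub>\<approx>w\<in>UNIV. fermat_x (\<alpha> * \<beta> * w + b) = \<alpha> * fermat_x w"
    "\<forall>\<^sub>\<approx>w\<in>UNIV. fermat_y (\<alpha> * \<beta> * w + b) = \<beta> * fermat_y w"
proof -
  have nz: "\<alpha> \<noteq> 0" "\<beta> \<noteq> 0" using assms by auto
  have "nonconstant_meromorphic (\<lambda>w. \<alpha> * fermat_x w)"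
    unfolding nonconstant_meromorphic_def
  proof (intro conjI notI meromorphic_intros fermat_x_meromorphic)
    assume "\<exists>a. \<forall>\<^sub>\<approx>w\<in>UNIV. \<alpha> * fermat_x w = a"
    then obtain a where "\<forall>\<^sub>\<approx>w\<in>UNIV. \<alpha> * fermat_x w = a" by blast
    hence "\<forall>\<^sub>\<approx>w\<in>UNIV. fermat_x w = a / \<alpha>"
      by eventually_elim (use nz in \<open>simp add: field_simps\<close>)
    thus False using fermat_x_nonconstant by (auto simp: nonconstant_meromorphic_def)
  qed
  moreover have "(\<lambda>w. \<beta> * fermat_y w) meromorphic_on UNIV"
    by (intro meromorphic_intros fermat_y_meromorphic)
  moreover have "\<forall>\<^sub>\<approx>w\<in>UNIV. (\<alpha> * fermat_x w) ^ 3 + (\<beta> * fermat_y w) ^ 3 = 1"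
    using cosparse_fermat_cubes by eventually_elim (simp add: power_mult_distrib assms)
  ultimately obtain h where h: "nonconstant_entire h"
    "\<forall>\<^sub>\<approx>w\<in>UNIV. fermat_x (h w) = \<alpha> * fermat_x w" "\<forall>\<^sub>\<approx>w\<in>UNIV. fermat_y (h w) = \<beta> * fermat_y w"
    "\<forall>\<^sub>\<approx>w\<in>UNIV. deriv h w = deriv (\<lambda>w. \<alpha> * fermat_x w) w / (sqrt3 * (\<beta> * fermat_y w) ^ 2)"
    by (rule fermat_lift)
  have hh: "h holomorphic_on UNIV" using h(1) by (simp add: nonconstant_entire_def)
  have "\<forall>\<^sub>\<approx>w\<in>UNIV. deriv h w = \<alpha> * \<beta>"
    using h(4) deriv_fermat_x cosparse_fermat_y_nonzero
      meromorphic_on_imp_analytic_cosparse[OF fermat_x_meromorphic]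
  proof eventually_elim
    case (elim w)
    have "deriv (\<lambda>w. \<alpha> * fermat_x w) w = \<alpha> * deriv fermat_x w"
      using elim analytic_on_imp_differentiable_at by (intro deriv_cmult) blast
    hence "deriv h w = \<alpha> / \<beta> ^ 2" using elim by (simp add: power_mult_distrib)
    also have "\<dots> = \<alpha> * \<beta>"
      using assms(2) nz by (simp add: field_simps power2_eq_square power3_eq_cube)
    finally show ?case .
  qed
  hence dh: "deriv h w = \<alpha> * \<beta>" for w
    by (intro entire_identity[of "deriv h" "\<lambda>_. \<alpha> * \<beta>"]) (auto intro!: holomorphic_deriv hh)
  have "\<exists>c. \<forall>w\<in>UNIV. h w - \<alpha> * \<beta> * w = c"
  proof (rule has_field_derivative_zero_constant)
    show "((\<lambda>w. h w - \<alpha> * \<beta> * w) has_field_derivative 0) (at w within UNIV)" for w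
      using holomorphic_derivI[OF hh open_UNIV, of w] by (auto intro!: derivative_eq_intros simp: dh)
  qed simp
  then obtain b where "\<And>w. h w - \<alpha> * \<beta> * w = b" by auto
  hence "h w = \<alpha> * \<beta> * w + b" for w by (simp add: algebra_simps flip: eq_diff_eq)
  thus ?thesis using that[of b] h(2,3) by simp
qed

lemma wp_eq_of_fermat_eq:
  assumes "fermat_x u = a" "fermat_y u = b" "wp u \<noteq> 0"
  shows "wp u = 1 / (a + b)"
  using wp_of_fermat(1)[OF assms(3)] assms by simp

lemma wp_scaled:
  assumes nz: "m \<noteq> 0"
    and "\<forall>\<^sub>\<approx>w\<in>UNIV. fermat_x (m * w + b) = \<alpha> * fermat_x w"
    and "\<forall>\<^sub>\<approx>w\<in>UNIV. fermat_y (m * w + b) = \<beta> * fermat_y w"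
  shows "\<forall>\<^sub>\<approx>w\<in>UNIV. wp (m * w + b) = 1 / (\<alpha> * fermat_x w + \<beta> * fermat_y w)"
  using assms(2,3) cosparse_compose_entire[OF nonconstant_entire_affine[OF nz, of b] cosparse_wp_neq[of 0]]
  by eventually_elim (rule wp_eq_of_fermat_eq)

text \<open>By the differential equation \<open>\<wp>'^2\<close> grows like \<open>4 \<wp>^3\<close> at the pole.\<close>

lemma wp_quotients_vanish:
  shows "((\<lambda>w. 1 / wp' w) \<longlongrightarrow> 0) (at 0)" "((\<lambda>w. wp w / wp' w) \<longlongrightarrow> 0) (at 0)"
proof -
  define v where "v = (\<lambda>w. inverse (wp w))"
  have v: "(v \<longlongrightarrow> 0) (at 0)"
    unfolding v_def by (rule filterlim_compose[OF tendsto_inverse_0 wp_at_infinity])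
  have ev: "eventually (\<lambda>w. wp' w ^ 2 = wp w ^ 3 * (4 - v w ^ 3) \<and> wp w \<noteq> 0) (at 0)"
  proof -
    have "eventually (\<lambda>w. wp w \<noteq> 0) (at 0)" using cosparse_wp_neq[of 0] by (simp add: cosparse_UNIV_iff)
    with eventually_notin_L[of 0] show ?thesis
      by eventually_elim (simp add: ode v_def right_diff_distrib power_inverse)
  qed
  have "((\<lambda>w. v w ^ 3 / (4 - v w ^ 3)) \<longlongrightarrow> 0 ^ 3 / (4 - 0 ^ 3)) (at 0)"
    by (intro tendsto_intros v) simp
  moreover have "eventually (\<lambda>w. v w ^ 3 / (4 - v w ^ 3) = (1 / wp' w) ^ 2) (at 0)"
    using ev by eventually_elim (simp add: power_divide v_def power_inverse divide_inverse)
  ultimately have "((\<lambda>w. (1 / wp' w) ^ 2) \<longlongrightarrow> 0 ^ 3 / (4 - 0 ^ 3)) (at 0)"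
    by (rule Lim_transform_eventually)
  hence "((\<lambda>w. (1 / wp' w) ^ 2) \<longlongrightarrow> 0) (at 0)" by simp
  thus "((\<lambda>w. 1 / wp' w) \<longlongrightarrow> 0) (at 0)" by (rule tendsto_zero_of_square)
  have "((\<lambda>w. v w / (4 - v w ^ 3)) \<longlongrightarrow> 0 / (4 - 0 ^ 3)) (at 0)"
    by (intro tendsto_intros v) simp
  moreover have "eventually (\<lambda>w. v w / (4 - v w ^ 3) = (wp w / wp' w) ^ 2) (at 0)"
    using ev
  proof eventually_elim
    case (elim w)
    have "v w / D = wp w ^ 2 / (wp w ^ 3 * D)" for D
      using elim by (simp add: v_def power2_eq_square power3_eq_cube divide_simps)
    thus ?case using elim by (simp add: power_divide)
  qed
  ultimately have "((\<lambda>w. (wp w / wp' w) ^ 2) \<longlongrightarrow> 0 / (4 - 0 ^ 3)) (at 0)"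
    by (rule Lim_transform_eventually)
  hence "((\<lambda>w. (wp w / wp' w) ^ 2) \<longlongrightarrow> 0) (at 0)" by simp
  thus "((\<lambda>w. wp w / wp' w) \<longlongrightarrow> 0) (at 0)" by (rule tendsto_zero_of_square)
qed

lemma fermat_combination:
  assumes "wp w \<noteq> 0"
  shows "1 / (\<alpha> * fermat_x w + \<beta> * fermat_y w) = 2 * wp w / (\<alpha> + \<beta> + (\<alpha> - \<beta>) * (wp' w / sqrt3))"
proof -
  have "\<alpha> * (1/2 * (1 + t)) + \<beta> * (1/2 * (1 - t)) = (\<alpha> + \<beta> + (\<alpha> - \<beta>) * t) / 2" for t :: complex
    by (simp add: field_simps)
  moreover have "\<alpha> * fermat_x w + \<beta> * fermat_y w =
      (\<alpha> * (1/2 * (1 + wp' w / sqrt3)) + \<beta> * (1/2 * (1 - wp' w / sqrt3))) / wp w"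
    unfolding fermat_x_def fermat_y_def by (simp only: times_divide_eq_right add_divide_distrib)
  ultimately have "\<alpha> * fermat_x w + \<beta> * fermat_y w = (\<alpha> + \<beta> + (\<alpha> - \<beta>) * (wp' w / sqrt3)) / 2 / wp w"
    by (simp only:)
  thus ?thesis by simp
qed

text \<open>Compare the behaviour of \<open>\<wp> (m w + b) = 1 / (\<alpha> X + \<beta> Y)\<close> at \<open>w = 0\<close>. The right hand side is
  \<open>2 \<wp> / (\<alpha> + \<beta> + (\<alpha> - \<beta>) \<wp>' / \<surd>3)\<close>, which tends to infinity if \<open>\<alpha> = \<beta>\<close> and to \<open>0\<close> otherwise, as
  \<open>\<wp>'\<close> dominates \<open>\<wp>\<close>.\<close>

lemma scaling_offset:
  assumes nz: "m \<noteq> 0" "\<alpha> \<noteq> 0"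
    and "\<forall>\<^sub>\<approx>w\<in>UNIV. fermat_x (m * w + b) = \<alpha> * fermat_x w"
    and "\<forall>\<^sub>\<approx>w\<in>UNIV. fermat_y (m * w + b) = \<beta> * fermat_y w"
  shows "(\<alpha> = \<beta> \<and> b \<in> L) \<or> (\<alpha> \<noteq> \<beta> \<and> b \<notin> L \<and> wp b = 0)"
proof -
  have wpnz: "eventually (\<lambda>w. wp w \<noteq> 0) (at 0)" using cosparse_wp_neq[of 0] by (simp add: cosparse_UNIV_iff)
  have "eventually (\<lambda>w. wp (m * w + b) = 1 / (\<alpha> * fermat_x w + \<beta> * fermat_y w)) (at 0)"
    using wp_scaled[OF nz(1) assms(3,4)] by (simp add: cosparse_UNIV_iff)
  with wpnz have eq: "eventually (\<lambda>w. 2 * wp w / (\<alpha> + \<beta> + (\<alpha> - \<beta>) * (wp' w / sqrt3)) = wp (m * w + b)) (at 0)"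
  proof eventually_elim
    case (elim w)
    show ?case unfolding elim(2) by (rule fermat_combination[OF elim(1), symmetric])
  qed
  have "((\<lambda>w. m * w + b) \<longlongrightarrow> m * 0 + b) (at 0)" by (intro tendsto_intros)
  moreover have "eventually (\<lambda>w. m * w + b \<noteq> b) (at 0)"
    using nz(1) by (auto simp: eventually_at_filter)
  ultimately have lin: "filterlim (\<lambda>w. m * w + b) (at b) (at 0)"
    by (intro filterlim_atI) auto
  have inL: "filterlim (\<lambda>w. wp (m * w + b)) at_infinity (at 0)" if "b \<in> L"
    using filterlim_compose[OF _ lin] is_pole_wp[OF that] by (simp add: is_pole_def)
  have notinL: "((\<lambda>w. wp (m * w + b)) \<longlongrightarrow> wp b) (at 0)" if "b \<notin> L"
  proof -
    have "wp \<midarrow>b\<rightarrow> wp b" using DERIV_isCont[OF wp_derivative_sum(1)[OF that]] by (simp add: isCont_def)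
    thus ?thesis using lin by (rule filterlim_compose)
  qed
  have nonzero_bot: "at (0 :: complex) \<noteq> bot" by simp
  show ?thesis
  proof (cases "\<alpha> = \<beta>")
    case True
    have inf: "filterlim (\<lambda>w. inverse \<alpha> * wp w) at_infinity (at 0)"
      using nz(2) wp_at_infinity by (intro tendsto_mult_filterlim_at_infinity[OF tendsto_const]) auto
    have "eventually (\<lambda>w. inverse \<alpha> * wp w = wp (m * w + b)) (at 0)"
      using eq by eventually_elim (use nz True in \<open>simp add: field_simps\<close>)
    from inf filterlim_cong[OF refl refl this]
    have "filterlim (\<lambda>w. wp (m * w + b)) at_infinity (at 0)" by blast
    hence "b \<in> L" using notinL not_tendsto_and_filterlim_at_infinity[OF nonzero_bot] by blast
    thus ?thesis using True by simp
  next
    case False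
    have "((\<lambda>w. 2 * (wp w / wp' w) / ((\<alpha> + \<beta>) * (1 / wp' w) + (\<alpha> - \<beta>) / sqrt3))
        \<longlongrightarrow> 2 * 0 / ((\<alpha> + \<beta>) * 0 + (\<alpha> - \<beta>) / sqrt3)) (at 0)"
      using False by (intro tendsto_intros wp_quotients_vanish) simp
    moreover have "eventually (\<lambda>w. 2 * (wp w / wp' w) / ((\<alpha> + \<beta>) * (1 / wp' w) + (\<alpha> - \<beta>) / sqrt3)
        = wp (m * w + b)) (at 0)"
    proof -
      have "eventually (\<lambda>w. wp' w \<noteq> 0) (at 0)" using cosparse_wp'_nonzero by (simp add: cosparse_UNIV_iff)
      with eq show ?thesis
      proof eventually_elim
        case (elim w)
        have "(\<alpha> + \<beta>) * (1 / wp' w) + (\<alpha> - \<beta>) / sqrt3 = (\<alpha> + \<beta> + (\<alpha> - \<beta>) * (wp' w / sqrt3)) / wp' w"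
          using elim(2) by (simp add: add_divide_distrib)
        thus ?case using elim by simp
      qed
    qed
    ultimately have "((\<lambda>w. wp (m * w + b)) \<longlongrightarrow> 2 * 0 / ((\<alpha> + \<beta>) * 0 + (\<alpha> - \<beta>) / sqrt3)) (at 0)"
      by (rule Lim_transform_eventually)
    hence lim0: "((\<lambda>w. wp (m * w + b)) \<longlongrightarrow> 0) (at 0)" by simp
    have "b \<notin> L" using inL lim0 not_tendsto_and_filterlim_at_infinity[OF nonzero_bot] by blast
    moreover from this have "wp b = 0" using notinL lim0 LIM_unique by blast
    ultimately show ?thesis using False by simp
  qed
qed

text \<open>By uniqueness of local lifts \<open>\<wp> (z + a)\<close> and \<open>\<wp> (z + b)\<close> coincide, so \<open>a - b\<close> is a period of \<open>\<wp>\<close>.\<close>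

lemma wp_separates_points:
  assumes "a \<notin> L" "b \<notin> L" "wp a = wp b" "wp' a = wp' b" "wp' a \<noteq> 0"
  shows "a - b \<in> L"
proof -
  have "wp' holomorphic_on - L" using wp_holomorphic open_compl_L by (rule holomorphic_deriv)
  hence "continuous_on (- L) wp'" by (rule holomorphic_on_imp_continuous_on)
  hence "open (- L \<inter> wp' -` (- {0}))" by (intro continuous_open_preimage open_compl_L) auto
  moreover have "a \<in> - L \<inter> wp' -` (- {0})" using assms by simp
  ultimately obtain r where r: "r > 0" "ball a r \<subseteq> - L \<inter> wp' -` (- {0})"
    by (metis open_contains_ball)
  have ab: "z + a \<in> ball a r" if "z \<in> ball 0 r" for z
    using that by (simp add: dist_norm)
  have ball: "z + a \<notin> L" "wp' (z + a) \<noteq> 0" if "z \<in> ball 0 r" for z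
    using r(2) ab[OF that] by auto
  have shift: "(\<lambda>z. z + a) holomorphic_on ball 0 r" by (intro holomorphic_intros)
  have img: "(\<lambda>z. z + a) ` ball 0 r \<subseteq> - L" using ball by blast
  have dx: "deriv (\<lambda>z. wp (z + a)) z = wp' (z + a)" if "z \<in> ball 0 r" for z
    using wp_derivative_sum(1)[OF ball(1)[OF that]] unfolding DERIV_shift by (rule DERIV_imp_deriv)
  have hol: "(\<lambda>z. wp (z + a)) holomorphic_on ball 0 r" "(\<lambda>z. wp' (z + a)) holomorphic_on ball 0 r"
    using holomorphic_on_compose_gen[OF shift wp_holomorphic img]
      holomorphic_on_compose_gen[OF shift \<open>wp' holomorphic_on - L\<close> img] unfolding o_def by blast+
  have curve: "wp' (z + a) ^ 2 = 4 * wp (z + a) ^ 3 - 1" if "z \<in> ball 0 r" for z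
    by (rule ode[OF ball(1)[OF that]])
  have der: "((\<lambda>z. z + b) has_field_derivative deriv (\<lambda>z. wp (z + a)) z / wp' (z + a)) (at z)"
    if "z \<in> ball 0 r" for z
  proof -
    have "deriv (\<lambda>z. wp (z + a)) z / wp' (z + a) = 1" using dx[OF that] ball(2)[OF that] by simp
    thus ?thesis by (auto intro!: derivative_eq_intros)
  qed
  have init: "0 + b \<notin> L" "wp (0 + b) = wp (0 + a)" "wp' (0 + b) = wp' (0 + a)"
    using assms by simp_all
  obtain s where s: "s > 0" "\<And>z. z \<in> ball 0 s \<Longrightarrow> wp (z + b) = wp (z + a) \<and> wp' (z + b) = wp' (z + a)"
    by (rule wp_local_lift[OF r(1) hol curve ball(2) der init]) (assumption | rule that)+
  have "eventually (\<lambda>z. z \<in> ball 0 s) (at (0 :: complex))"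
    using s(1) by (intro eventually_at_in_open') auto
  hence ev: "eventually (\<lambda>z. wp (z + a) = wp (z + b)) (at 0)" by eventually_elim (use s(2) in auto)
  have mero: "(\<lambda>z. wp (z + u)) meromorphic_on UNIV" for u
    by (rule meromorphic_compose_entire[OF wp_meromorphic]) (intro holomorphic_intros)
  have "\<forall>\<^sub>\<approx>z\<in>UNIV. wp (z + a) = wp (z + b)"
    by (rule meromorphic_identity[OF mero mero ev])
  from cosparse_compose_entire[OF nonconstant_entire_shift[of "- b"] this]
  have "\<forall>\<^sub>\<approx>z\<in>UNIV. wp (z + (a - b)) = wp z" by (simp add: algebra_simps)
  thus ?thesis by (rule period_of_wp)
qed

lemma zero_of_wp_cases:
  assumes "b \<notin> L" "wp b = 0"
    and \<theta>: "\<theta>\<^sub>1 \<notin> L" "wp \<theta>\<^sub>1 = 0" "wp' \<theta>\<^sub>1 = - \<i>" "\<theta>\<^sub>2 \<notin> L" "wp \<theta>\<^sub>2 = 0" "wp' \<theta>\<^sub>2 = \<i>"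
  shows "b - \<theta>\<^sub>1 \<in> L \<or> b - \<theta>\<^sub>2 \<in> L"
proof -
  have "wp' b ^ 2 = \<i> ^ 2" using ode[OF assms(1)] assms(2) by simp
  hence "wp' b = \<i> \<or> wp' b = - \<i>" by (simp only: power2_eq_iff)
  thus ?thesis using wp_separates_points[of b \<theta>\<^sub>1] wp_separates_points[of b \<theta>\<^sub>2] assms by auto
qed

text \<open>The quotient of this group by the lattice acts on the cubic by translations that multiply \<open>X\<close>
  by cube roots of unity.\<close>

definition cube_periods :: "complex set" where
  "cube_periods = {p. \<forall>\<^sub>\<approx>w\<in>UNIV. fermat_x (w + p) ^ 3 = fermat_x w ^ 3}"

lemma cube_periods_add:
  assumes "p \<in> cube_periods" "q \<in> cube_periods"
  shows "p + q \<in> cube_periods"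
proof -
  have p: "\<forall>\<^sub>\<approx>w\<in>UNIV. fermat_x (w + p) ^ 3 = fermat_x w ^ 3" and q: "\<forall>\<^sub>\<approx>w\<in>UNIV. fermat_x (w + q) ^ 3 = fermat_x w ^ 3"
    using assms by (auto simp: cube_periods_def)
  have "\<forall>\<^sub>\<approx>w\<in>UNIV. fermat_x (w + p + q) ^ 3 = fermat_x (w + p) ^ 3"
    using cosparse_compose_entire[OF nonconstant_entire_shift q] .
  with p have "\<forall>\<^sub>\<approx>w\<in>UNIV. fermat_x (w + (p + q)) ^ 3 = fermat_x w ^ 3"
    by eventually_elim (simp add: add.assoc)
  thus ?thesis by (simp add: cube_periods_def)
qed

lemma cube_periods_minus:
  assumes "p \<in> cube_periods"
  shows "- p \<in> cube_periods"
proof -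
  have "\<forall>\<^sub>\<approx>w\<in>UNIV. fermat_x (w + p) ^ 3 = fermat_x w ^ 3" using assms by (simp add: cube_periods_def)
  from cosparse_compose_entire[OF nonconstant_entire_shift[of "- p"] this]
  show ?thesis by (simp add: cube_periods_def eq_commute)
qed

lemma fermat_x_periodic: "w \<notin> L \<Longrightarrow> \<tau> \<in> L \<Longrightarrow> fermat_x (w + \<tau>) = fermat_x w"
  and fermat_y_periodic: "w \<notin> L \<Longrightarrow> \<tau> \<in> L \<Longrightarrow> fermat_y (w + \<tau>) = fermat_y w"
  by (simp_all add: fermat_x_def fermat_y_def wp_periodic wp'_periodic)

lemma L_cube_periods: "\<tau> \<in> L \<Longrightarrow> \<tau> \<in> cube_periods"
  unfolding cube_periods_def mem_Collect_eq
  using cosparse_notin_L by eventually_elim (simp add: fermat_x_periodic)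

text \<open>For a primitive cube root of unity \<open>\<zeta>\<close> the automorphism \<open>(\<zeta> X, \<zeta>^2 Y)\<close> fixes \<open>X^3\<close>, and it lifts to
  a translation because \<open>\<zeta> \<zeta>^2 = 1\<close>. The translation is by a zero of \<open>\<wp>\<close>, so congruent to one of the
  \<open>\<theta>\<close>'s; the other one is congruent to its negative.\<close>

lemma zeros_cube_periods:
  assumes \<theta>: "\<theta>\<^sub>1 \<notin> L" "wp \<theta>\<^sub>1 = 0" "wp' \<theta>\<^sub>1 = - \<i>" "\<theta>\<^sub>2 \<notin> L" "wp \<theta>\<^sub>2 = 0" "wp' \<theta>\<^sub>2 = \<i>"
  shows "\<theta>\<^sub>1 \<in> cube_periods" "\<theta>\<^sub>2 \<in> cube_periods"
proof -
  \<comment> \<open>The primitive third root of unity \<open>exp (2 \<pi> \<i> / 3)\<close>.\<close>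
  define \<zeta> :: complex where "\<zeta> = (- 1 + \<i> * sqrt3) / 2"
  have \<zeta>2: "\<zeta> ^ 2 = - 1 - \<zeta>"
  proof -
    have "\<zeta> ^ 2 = (1 - 2 * (\<i> * sqrt3) + (\<i> * sqrt3) * (\<i> * sqrt3)) / 4"
      unfolding \<zeta>_def power_divide by (simp add: power2_eq_square algebra_simps)
    also have "(\<i> * sqrt3) * (\<i> * sqrt3) = (\<i> * \<i>) * (sqrt3 * sqrt3)" by (simp only: mult_ac)
    also have "\<dots> = - 3" by (simp only: sqrt3_square i_squared) simp
    finally show ?thesis unfolding \<zeta>_def by (simp add: field_simps)
  qed
  have \<zeta>3: "\<zeta> ^ 3 = 1"
  proof -
    have "\<zeta> ^ 3 = \<zeta> * \<zeta> ^ 2" by (simp add: power2_eq_square power3_eq_cube)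
    also have "\<dots> = - \<zeta> - \<zeta> ^ 2" unfolding \<zeta>2 by (simp add: algebra_simps power2_eq_square[symmetric] \<zeta>2)
    finally show ?thesis by (simp add: \<zeta>2)
  qed
  have ne: "\<zeta> \<noteq> \<zeta> ^ 2"
  proof
    assume "\<zeta> = \<zeta> ^ 2"
    hence "\<zeta> = 0 \<or> \<zeta> = 1" by (auto simp: power2_eq_square)
    thus False using \<zeta>2 by auto
  qed
  have \<zeta>6: "(\<zeta> ^ 2) ^ 3 = 1" using \<zeta>3 by (metis power_mult mult.commute power_one)
  have prod: "\<zeta> * \<zeta> ^ 2 = 1" using \<zeta>3 by (simp add: power2_eq_square power3_eq_cube mult.assoc)
  obtain b where b: "\<forall>\<^sub>\<approx>w\<in>UNIV. fermat_x (1 * w + b) = \<zeta> * fermat_x w"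
    "\<forall>\<^sub>\<approx>w\<in>UNIV. fermat_y (1 * w + b) = \<zeta> ^ 2 * fermat_y w"
    using fermat_scaling[OF \<zeta>3 \<zeta>6] unfolding prod by blast
  have "\<zeta> \<noteq> 0" using \<zeta>3 by auto
  from scaling_offset[OF _ this b] ne have b0: "b \<notin> L" "wp b = 0" by auto
  have bP: "b \<in> cube_periods"
    unfolding cube_periods_def mem_Collect_eq
    using b(1) by eventually_elim (simp add: power_mult_distrib \<zeta>3)
  have "- \<theta>\<^sub>1 - \<theta>\<^sub>2 \<in> L"
    using \<theta> wp'_odd[of \<theta>\<^sub>1] by (intro wp_separates_points) (auto simp: wp_even)
  hence L12: "\<theta>\<^sub>1 + \<theta>\<^sub>2 \<in> L" using L_minus_iff[of "\<theta>\<^sub>1 + \<theta>\<^sub>2"] by simp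
  have "\<theta>\<^sub>1 \<in> cube_periods \<or> \<theta>\<^sub>2 \<in> cube_periods"
    using zero_of_wp_cases[OF b0 \<theta>] cube_periods_add[OF bP cube_periods_minus[OF L_cube_periods]]
    by (auto dest!: spec) (metis add_diff_cancel_left' diff_add_cancel diff_conv_add_uminus minus_diff_eq)+
  moreover have "\<theta>\<^sub>2 = (\<theta>\<^sub>1 + \<theta>\<^sub>2) + (- \<theta>\<^sub>1)" "\<theta>\<^sub>1 = (\<theta>\<^sub>1 + \<theta>\<^sub>2) + (- \<theta>\<^sub>2)" by simp_all
  ultimately show "\<theta>\<^sub>1 \<in> cube_periods" "\<theta>\<^sub>2 \<in> cube_periods"
    using cube_periods_add[OF L_cube_periods[OF L12]] cube_periods_minus by metis+
qed

section \<open>The functional equation\<close>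

text \<open>The right hand sides have period \<open>\<tau>\<close>, so \<open>\<wp>\<close> has period \<open>m \<tau>\<close>.\<close>

lemma multiplier_preserves_L:
  assumes nz: "m \<noteq> 0"
    and "\<forall>\<^sub>\<approx>w\<in>UNIV. fermat_x (m * w + b) = \<alpha> * fermat_x w"
    and "\<forall>\<^sub>\<approx>w\<in>UNIV. fermat_y (m * w + b) = \<beta> * fermat_y w"
    and \<tau>: "\<tau> \<in> L"
  shows "m * \<tau> \<in> L"
proof -
  note eq = wp_scaled[OF assms(1-3)]
  have "\<forall>\<^sub>\<approx>w\<in>UNIV. wp (m * w + b + m * \<tau>) = wp (m * w + b)"
    using eq cosparse_compose_entire[OF nonconstant_entire_shift[of \<tau>] eq] cosparse_notin_L
  proof eventually_elim
    case (elim w)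
    have "wp (m * w + b + m * \<tau>) = wp (m * (w + \<tau>) + b)" by (simp add: algebra_simps)
    also have "\<dots> = wp (m * w + b)"
      unfolding elim(1,2) using elim(3) \<tau> by (simp add: fermat_x_periodic fermat_y_periodic)
    finally show ?case .
  qed
  from cosparse_compose_entire[OF nonconstant_entire_affine[of "1 / m" "- b / m"] this] nz
  have "\<forall>\<^sub>\<approx>w\<in>UNIV. wp (m * (1 / m * w + - b / m) + b + m * \<tau>) = wp (m * (1 / m * w + - b / m) + b)"
    by simp
  moreover have "m * (1 / m * w + - b / m) + b = w" for w using nz by (simp add: field_simps)
  ultimately have "\<forall>\<^sub>\<approx>w\<in>UNIV. wp (w + m * \<tau>) = wp w" by simp
  thus ?thesis by (rule period_of_wp)
qed

text \<open>Both lifts have the same \<open>\<wp>\<close> and \<open>\<wp>'\<close>, so their difference takes values in the lattice almost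
  everywhere, whereas a nonconstant entire function avoids the lattice almost everywhere.\<close>

lemma entire_lifts_differ_by_period:
  assumes h: "h holomorphic_on UNIV" and k: "nonconstant_entire k"
    and "\<forall>\<^sub>\<approx>z\<in>UNIV. h z \<notin> L"
    and "\<forall>\<^sub>\<approx>z\<in>UNIV. fermat_x (h z) = fermat_x (k z)" "\<forall>\<^sub>\<approx>z\<in>UNIV. fermat_y (h z) = fermat_y (k z)"
    and "\<forall>\<^sub>\<approx>z\<in>UNIV. wp (h z) \<noteq> 0"
  obtains \<tau> where "\<tau> \<in> L" "\<And>z. h z = k z + \<tau>"
proof -
  have inL: "\<forall>\<^sub>\<approx>z\<in>UNIV. h z - k z \<in> L"
    using assms(3-6) cosparse_compose_entire[OF k cosparse_notin_L]
      cosparse_compose_entire[OF k cosparse_wp_neq[of 0]] cosparse_compose_entire[OF k cosparse_wp'_nonzero]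
  proof eventually_elim
    case (elim z)
    have "wp (h z) = wp (k z)" using wp_of_fermat(1)[of "h z"] wp_of_fermat(1)[of "k z"] elim by simp
    moreover have "wp' (h z) = wp' (k z)" using wp_of_fermat(2)[of "h z"] wp_of_fermat(2)[of "k z"] elim by simp
    ultimately show ?case using elim by (intro wp_separates_points) auto
  qed
  have "\<not> nonconstant_entire (\<lambda>z. h z - k z)"
  proof
    assume "nonconstant_entire (\<lambda>z. h z - k z)"
    from cosparse_compose_entire[OF this cosparse_notin_L] inL
    have "eventually (\<lambda>_. False) (cosparse (UNIV :: complex set))" by eventually_elim simp
    thus False by simp
  qed
  moreover have "(\<lambda>z. h z - k z) holomorphic_on UNIV"
    using h k by (auto simp: nonconstant_entire_def intro!: holomorphic_intros)
  ultimately obtain \<tau> where \<tau>: "\<And>z. h z - k z = \<tau>"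
    by (auto simp: nonconstant_entire_def constant_on_def)
  have "\<tau> \<in> L" using eventually_happens[OF inL] \<tau> by auto
  moreover have "h z = k z + \<tau>" for z using \<tau>[of z] by (simp add: algebra_simps)
  ultimately show ?thesis using that by blast
qed

text \<open>Applying the equation twice gives \<open>f (z + 2 c)^3 = f z^3\<close>, so \<open>f (z + 2 c) = \<eta> f z\<close> with a constant \<open>\<eta>\<close>.
  As \<open>w \<mapsto> - w\<close> exchanges the coordinates, \<open>- h (z + c)\<close> is a lift of \<open>(\<eta> f z, f (z + c))\<close>, that
  is, of the image of \<open>h z\<close> under \<open>(X, Y) \<mapsto> (\<eta> X, Y)\<close>.\<close>

lemma fermat_functional_equation_lift:
  assumes f: "nonconstant_meromorphic f"
    and eq: "\<forall>\<^sub>\<approx>z\<in>UNIV. f z ^ 3 + f (z + c) ^ 3 = 1"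
  obtains h \<eta> b where "nonconstant_entire h" "\<eta> ^ 3 = 1" "\<forall>\<^sub>\<approx>z\<in>UNIV. fermat_x (h z) = f z"
    "\<And>z. h (z + c) = - \<eta> * h z + b" "b \<in> L \<or> wp b = 0" "\<And>\<tau>. \<tau> \<in> L \<Longrightarrow> - \<eta> * \<tau> \<in> L"
proof -
  have fm: "f meromorphic_on UNIV" and fnc: "\<not> (\<exists>a. \<forall>\<^sub>\<approx>z\<in>UNIV. f z = a)"
    using f by (auto simp: nonconstant_meromorphic_def)
  have shift: "(\<lambda>z. z + c) holomorphic_on UNIV" by (intro holomorphic_intros)
  have fcm: "(\<lambda>z. f (z + c)) meromorphic_on UNIV" using fm shift by (rule meromorphic_compose_entire)
  obtain h where h: "nonconstant_entire h" "\<forall>\<^sub>\<approx>z\<in>UNIV. fermat_x (h z) = f z"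
    "\<forall>\<^sub>\<approx>z\<in>UNIV. fermat_y (h z) = f (z + c)"
    using fermat_lift[OF f fcm eq] by metis
  have hh: "h holomorphic_on UNIV" using h(1) by (simp add: nonconstant_entire_def)
  note sh = cosparse_compose_entire[OF nonconstant_entire_shift[of c]]
  have hcm: "(\<lambda>z. h (z + c)) holomorphic_on UNIV"
    using holomorphic_on_compose_gen[OF shift hh] by (simp add: o_def)
  have fnz: "\<forall>\<^sub>\<approx>z\<in>UNIV. f z \<noteq> 0"
    using meromorphic_imp_constant_or_avoid[OF fm open_UNIV connected_UNIV, of 0] fnc by blast
  have gm: "(\<lambda>z. fermat_y (h (z + c)) / f z) meromorphic_on UNIV"
    using meromorphic_compose_entire[OF fermat_y_meromorphic hcm] fm by (intro meromorphic_intros)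
  have "\<forall>\<^sub>\<approx>z\<in>UNIV. (fermat_y (h (z + c)) / f z) ^ 3 = 1"
    using fnz eq sh[OF eq] sh[OF h(3)]
  proof eventually_elim
    case (elim z)
    have "fermat_y (h (z + c)) ^ 3 = f z ^ 3" using elim by (simp add: algebra_simps) (metis add_left_cancel add.commute)
    thus ?case using elim by (simp add: power_divide)
  qed
  from meromorphic_cube_constant[OF gm this]
  obtain \<eta> where \<eta>: "\<eta> ^ 3 = 1" and \<eta>': "\<forall>\<^sub>\<approx>z\<in>UNIV. fermat_y (h (z + c)) / f z = \<eta>" by blast
  have \<eta>0: "\<eta> \<noteq> 0" using \<eta> by auto
  obtain b where b: "\<forall>\<^sub>\<approx>w\<in>UNIV. fermat_x (\<eta> * w + b) = \<eta> * fermat_x w"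
    "\<forall>\<^sub>\<approx>w\<in>UNIV. fermat_y (\<eta> * w + b) = 1 * fermat_y w"
    using fermat_scaling[OF \<eta>, of 1] by auto
  have off: "b \<in> L \<or> wp b = 0" using scaling_offset[OF \<eta>0 \<eta>0 b] by blast
  define k where "k = (\<lambda>z. - h (z + c))"
  have kh: "k holomorphic_on UNIV" unfolding k_def by (intro holomorphic_intros hcm)
  have knL: "\<forall>\<^sub>\<approx>z\<in>UNIV. k z \<notin> L"
    using sh[OF cosparse_compose_entire[OF h(1) cosparse_notin_L]] by (simp add: k_def)
  have kw: "\<forall>\<^sub>\<approx>z\<in>UNIV. wp (k z) \<noteq> 0"
    using sh[OF cosparse_compose_entire[OF h(1) cosparse_wp_neq[of 0]]] by (simp add: k_def wp_even)
  have lin: "nonconstant_entire (\<lambda>z. \<eta> * h z + b)"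
  proof -
    have "\<not> (\<lambda>z. \<eta> * h z + b) constant_on UNIV"
    proof
      assume "(\<lambda>z. \<eta> * h z + b) constant_on UNIV"
      then obtain a where "\<And>z. \<eta> * h z + b = a" by (auto simp: constant_on_def)
      hence "h z = (a - b) / \<eta>" for z using \<eta>0 by (metis add_diff_cancel_right' nonzero_mult_div_cancel_left)
      thus False using h(1) by (auto simp: nonconstant_entire_def constant_on_def)
    qed
    thus ?thesis using hh by (auto simp: nonconstant_entire_def intro!: holomorphic_intros)
  qed
  have kx: "\<forall>\<^sub>\<approx>z\<in>UNIV. fermat_x (k z) = fermat_x (\<eta> * h z + b)"
    using cosparse_compose_entire[OF h(1) b(1)] \<eta>' fnz h(2) knL
  proof eventually_elim
    case (elim z)
    have "fermat_x (k z) = fermat_y (h (z + c))" using fermat_minus[of "h (z + c)"] elim by (simp add: k_def)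
    thus ?case using elim by (simp add: field_simps)
  qed
  have ky: "\<forall>\<^sub>\<approx>z\<in>UNIV. fermat_y (k z) = fermat_y (\<eta> * h z + b)"
    using cosparse_compose_entire[OF h(1) b(2)] sh[OF h(2)] h(3) knL
  proof eventually_elim
    case (elim z)
    have "fermat_y (k z) = fermat_x (h (z + c))" using fermat_minus[of "h (z + c)"] elim by (simp add: k_def)
    thus ?case using elim by simp
  qed
  obtain \<tau> where \<tau>: "\<tau> \<in> L" "\<And>z. k z = \<eta> * h z + b + \<tau>"
    using entire_lifts_differ_by_period[OF kh lin knL kx ky kw] by blast
  have "h (z + c) = - \<eta> * h z + - (b + \<tau>)" for z
    using \<tau>(2)[of z] by (simp add: k_def algebra_simps minus_equation_iff[of "h (c + z)"])
  moreover have "- (b + \<tau>) \<in> L \<or> wp (- (b + \<tau>)) = 0"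
    using off \<tau>(1) wp_periodic[of b \<tau>]
    by (cases "b \<in> L") (auto simp: wp_even L_add L_add_iff simp del: minus_add_distrib)
  moreover have "- \<eta> * \<sigma> \<in> L" if "\<sigma> \<in> L" for \<sigma>
    using multiplier_preserves_L[OF \<eta>0 b that] by simp
  ultimately show ?thesis using that[OF h(1) \<eta> h(2)] by blast
qed

text \<open>Modulo periods of \<open>X^3\<close> both \<open>p\<close> and the offset of the lift of \<open>(\<eta> X, Y)\<close> may be dropped, so
  \<open>X (- \<eta> w + p)^3 = X (- \<eta> w)^3 = Y (\<eta> w)^3 = 1 - X (\<eta> w)^3 = 1 - X w^3\<close>.\<close>

lemma fermat_functional_equation_of_lift:
  assumes h: "nonconstant_entire h" and f: "\<forall>\<^sub>\<approx>z\<in>UNIV. f z = fermat_x (h z)"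
    and \<eta>: "\<eta> ^ 3 = 1" and step: "\<And>z. h (z + c) = - \<eta> * h z + p" and p: "p \<in> cube_periods"
    and zeros: "\<And>b. b \<notin> L \<Longrightarrow> wp b = 0 \<Longrightarrow> b \<in> cube_periods"
  shows "\<forall>\<^sub>\<approx>z\<in>UNIV. f z ^ 3 + f (z + c) ^ 3 = 1"
proof -
  have \<eta>0: "\<eta> \<noteq> 0" using \<eta> by auto
  obtain b where b: "\<forall>\<^sub>\<approx>w\<in>UNIV. fermat_x (\<eta> * w + b) = \<eta> * fermat_x w"
    "\<forall>\<^sub>\<approx>w\<in>UNIV. fermat_y (\<eta> * w + b) = 1 * fermat_y w"
    using fermat_scaling[OF \<eta>, of 1] by auto
  have "b \<in> cube_periods" using scaling_offset[OF \<eta>0 \<eta>0 b] zeros L_cube_periods by blast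
  hence bP: "\<forall>\<^sub>\<approx>w\<in>UNIV. fermat_x (w + b) ^ 3 = fermat_x w ^ 3" by (simp add: cube_periods_def)
  have pP: "\<forall>\<^sub>\<approx>w\<in>UNIV. fermat_x (w + p) ^ 3 = fermat_x w ^ 3" using p by (simp add: cube_periods_def)
  have lin: "nonconstant_entire (\<lambda>w. \<eta> * w)" "nonconstant_entire (\<lambda>w. - \<eta> * w)"
    using nonconstant_entire_affine[of \<eta> 0] nonconstant_entire_affine[of "- \<eta>" 0] \<eta>0 by simp_all
  have "\<forall>\<^sub>\<approx>w\<in>UNIV. fermat_x w ^ 3 + fermat_x (- \<eta> * w + p) ^ 3 = 1"
    using b(1) cosparse_compose_entire[OF lin(2) pP] cosparse_compose_entire[OF lin(1) bP]
      cosparse_compose_entire[OF lin(1) cosparse_fermat_cubes] cosparse_compose_entire[OF lin(1) cosparse_notin_L]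
  proof eventually_elim
    case (elim w)
    have "fermat_x (- \<eta> * w + p) ^ 3 = fermat_y (\<eta> * w) ^ 3"
      using elim(2) fermat_minus(1)[OF elim(5)] by simp
    moreover have "fermat_x w ^ 3 = fermat_x (\<eta> * w) ^ 3"
      using elim(1,3) by (simp add: power_mult_distrib \<eta>)
    ultimately show ?case using elim(4) by simp
  qed
  from cosparse_compose_entire[OF h this] f cosparse_compose_entire[OF nonconstant_entire_shift[of c] f]
  show ?thesis by eventually_elim (simp add: step)
qed

end

theorem theorem1:
  fixes \<omega>\<^sub>1 \<omega>\<^sub>2 \<theta>\<^sub>1 \<theta>\<^sub>2 c :: complex
    and wp wp' f :: "complex \<Rightarrow> complex"
    and L :: "complex set"
  defines "L \<equiv> period_lattice \<omega>\<^sub>1 \<omega>\<^sub>2"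
    and "wp \<equiv> weierstrass_p \<omega>\<^sub>1 \<omega>\<^sub>2"
    and "wp' \<equiv> deriv (weierstrass_p \<omega>\<^sub>1 \<omega>\<^sub>2)"
  assumes "Im (\<omega>\<^sub>1 / \<omega>\<^sub>2) \<noteq> 0"
    and "\<And>z. z \<notin> L \<Longrightarrow> (wp' z) ^ 2 = 4 * (wp z) ^ 3 - 1"
    and "\<theta>\<^sub>1 \<in> period_parallelogram \<omega>\<^sub>1 \<omega>\<^sub>2" "\<theta>\<^sub>1 \<notin> L" "wp \<theta>\<^sub>1 = 0" "wp' \<theta>\<^sub>1 = - \<i>"
    and "\<theta>\<^sub>2 \<in> period_parallelogram \<omega>\<^sub>1 \<omega>\<^sub>2" "\<theta>\<^sub>2 \<notin> L" "wp \<theta>\<^sub>2 = 0" "wp' \<theta>\<^sub>2 = \<i>"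
    and "c \<noteq> 0"
    and "nonconstant_meromorphic f"
  shows "(\<forall>\<^sub>\<approx>z\<in>UNIV. (f z) ^ 3 + (f (z + c)) ^ 3 = 1) \<longleftrightarrow>
    (\<exists>h A. nonconstant_entire h \<and>
       A ^ 3 = -1 \<and> (\<forall>\<tau>\<in>L. A * \<tau> \<in> L) \<and>
       (\<forall>\<^sub>\<approx>z\<in>UNIV. f z = (1 / 2 * (1 + wp' (h z) / complex_of_real (sqrt 3))) / wp (h z)) \<and>
       ((\<exists>\<tau>\<^sub>1\<in>L. \<forall>z. h (z + c) = A * h z + \<theta>\<^sub>1 + \<tau>\<^sub>1) \<or>
        (\<exists>\<tau>\<^sub>2\<in>L. \<forall>z. h (z + c) = A * h z + \<theta>\<^sub>2 + \<tau>\<^sub>2) \<or>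
        (\<exists>\<tau>\<^sub>3\<in>L. \<forall>z. h (z + c) = A * h z + \<tau>\<^sub>3)))"
    (is "?lhs \<longleftrightarrow> (\<exists>h A. ?entire h \<and> ?cube A \<and> ?stable A \<and> ?rep h \<and> ?step h A)")
proof -
  interpret equianharmonic_lattice \<omega>\<^sub>1 \<omega>\<^sub>2
    by unfold_locales (use assms in simp_all)
  note \<theta> = assms(7-9,11-13)[unfolded L_def wp_def wp'_def]
  have zeros: "b - \<theta>\<^sub>1 \<in> L \<or> b - \<theta>\<^sub>2 \<in> L" if "b \<notin> L" "wp b = 0" for b
    using zero_of_wp_cases[OF _ _ \<theta>] that by (simp add: L_def wp_def)
  note \<theta>P = zeros_cube_periods[OF \<theta>]
  have rep: "?rep h \<longleftrightarrow> (\<forall>\<^sub>\<approx>z\<in>UNIV. f z = fermat_x (h z))" for h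
    by (simp only: fermat_x_def wp_def wp'_def)
  show ?thesis
  proof
    assume eq: ?lhs
    obtain h \<eta> b where h: "nonconstant_entire h" "\<eta> ^ 3 = 1" "\<forall>\<^sub>\<approx>z\<in>UNIV. fermat_x (h z) = f z"
      "\<And>z. h (z + c) = - \<eta> * h z + b" "b \<in> L \<or> wp b = 0" "\<And>\<tau>. \<tau> \<in> L \<Longrightarrow> - \<eta> * \<tau> \<in> L"
      by (rule fermat_functional_equation_lift[OF assms(15) eq, folded L_def wp_def]) (rule that)
    have "?step h (- \<eta>)"
    proof (cases "b \<in> L")
      case True
      thus ?thesis using h(4) by blast
    next
      case False
      have "h (z + c) = - \<eta> * h z + \<theta> + (b - \<theta>)" for z \<theta> using h(4) by simp
      thus ?thesis using zeros[of b] h(5) False by blast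
    qed
    moreover have "?rep h" unfolding rep using h(3) by (simp add: eq_commute)
    moreover have "(- \<eta>) ^ 3 = -1" using h(2) by simp
    ultimately show "\<exists>h A. ?entire h \<and> ?cube A \<and> ?stable A \<and> ?rep h \<and> ?step h A"
      using h(1,6) by blast
  next
    assume "\<exists>h A. ?entire h \<and> ?cube A \<and> ?stable A \<and> ?rep h \<and> ?step h A"
    then obtain h A where h: "?entire h" "?cube A" "?rep h" "?step h A" by blast
    have LP: "\<tau> \<in> cube_periods" if "\<tau> \<in> L" for \<tau> using that L_cube_periods by (simp add: L_def)
    obtain p where p: "\<And>z. h (z + c) = A * h z + p" "p \<in> cube_periods"
      using h(4)
    proof (elim disjE bexE)
      fix \<tau> assume \<tau>: "\<tau> \<in> L" "\<forall>z. h (z + c) = A * h z + \<theta>\<^sub>1 + \<tau>"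
      show thesis
        by (rule that[of "\<theta>\<^sub>1 + \<tau>"]) (use \<tau> \<theta>P LP cube_periods_add in \<open>simp_all add: add.assoc\<close>)
    next
      fix \<tau> assume \<tau>: "\<tau> \<in> L" "\<forall>z. h (z + c) = A * h z + \<theta>\<^sub>2 + \<tau>"
      show thesis
        by (rule that[of "\<theta>\<^sub>2 + \<tau>"]) (use \<tau> \<theta>P LP cube_periods_add in \<open>simp_all add: add.assoc\<close>)
    next
      fix \<tau> assume \<tau>: "\<tau> \<in> L" "\<forall>z. h (z + c) = A * h z + \<tau>"
      show thesis
        by (rule that[of \<tau>]) (use \<tau> LP in simp_all)
    qed
    show ?lhs
    proof (rule fermat_functional_equation_of_lift[where \<eta> = "- A"])
      show "nonconstant_entire h" by fact
      show "\<forall>\<^sub>\<approx>z\<in>UNIV. f z = fermat_x (h z)" using h(3) unfolding rep .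
      show "(- A) ^ 3 = 1" using h(2) by simp
      show "h (z + c) = - (- A) * h z + p" for z using p(1) by simp
      show "p \<in> cube_periods" by fact
      show "b \<in> cube_periods" if "b \<notin> period_lattice \<omega>\<^sub>1 \<omega>\<^sub>2" "weierstrass_p \<omega>\<^sub>1 \<omega>\<^sub>2 b = 0" for b
      proof -
        have "b - \<theta>\<^sub>1 \<in> L \<or> b - \<theta>\<^sub>2 \<in> L" using zeros[of b] that by (simp add: L_def wp_def)
        thus ?thesis using cube_periods_add[OF \<theta>P(1) LP, of "b - \<theta>\<^sub>1"] cube_periods_add[OF \<theta>P(2) LP, of "b - \<theta>\<^sub>2"]
          by auto
      qed
    qed
  qed
qed

end
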